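(* Let $n$ be a positive integer. There exists $\rho^*\in(0,1)$ such that for every controllable pair $(A,b)\in M_n(\mathbb{R})\times\mathbb{R}^n$, every $T>0$ and every $\rho\in(\rho^*,1]$ one has $\mathrm{RC}(A,T,\rho T)=\mathrm{RD}(A,T,\rho T)=+\infty$.
   Context: For $0<\mu\leq T$, $\mathcal{G}(T,\mu)$ denotes the set of all measurable functions $\alpha:[0,\infty)\to[0,1]$ such that $\int_t^{t+T}\alpha(s)\,ds\geq\mu$ for every $t\geq 0$. Let $(A,b)\in M_n(\mathbb{R})\times\mathbb{R}^n$ be a controllable pair. For $K\in\mathbb{R}^n$, $\alpha\in\mathcal{G}(T,\mu)$ and $x_0\in\mathbb{R}^n$, let $x(\cdot;0,x_0,K,\alpha)$ be the solution of $\dot x=(A-\alpha(t)bK^T)x$, $x(0)=x_0$. Define $$\lambda^+(\alpha,K)=\sup_{\|x_0\|=1}\limsup_{t\to+\infty}\frac{\log\|x(t;0,x_0,K,\alpha)\|}{t},\qquad \lambda^-(\alpha,K)=\inf_{\|x_0\|=1}\liminf_{t\to+\infty}\frac{\log\|x(t;0,x_0,K,\alpha)\|}{t},$$ $$\mathrm{rc}(A,b,T,\mu,K)=-\sup_{\alpha\in\mathcal{G}(T,\mu)}\lambda^+(\alpha,K),\qquad \mathrm{rd}(A,b,T,\mu,K)=\inf_{\alpha\in\mathcal{G}(T,\mu)}\lambda^-(\alpha,K),$$ $$\mathrm{RC}(A,T,\mu)=\sup_{K\in\mathbb{R}^n}\mathrm{rc}(A,b,T,\mu,K),\qquad \mathrm{RD}(A,T,\mu)=\sup_{K\in\mathbb{R}^n}\mathrm{rd}(A,b,T,\mu,K).$$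 The quantities $\mathrm{RC}(A,T,\mu)$ and $\mathrm{RD}(A,T,\mu)$ (maximal rates of convergence and divergence) do not depend on the choice of $b$ such that $(A,b)$ is controllable. *)

theory Defs
  imports "HOL-Analysis.Analysis"
begin

(* Caratheodory solutions of x' = f(t, x), x(0) = x0, on a time interval J with left end point 0.
   Absolute continuity together with the equation almost everywhere is expressed by the equivalent
   integral equation; only the values of x on J are constrained. *)
definition caratheodory_solution ::
  "real set \<Rightarrow> (real \<Rightarrow> 'a \<Rightarrow> 'a) \<Rightarrow> 'a \<Rightarrow> (real \<Rightarrow> 'a::euclidean_space) \<Rightarrow> bool"
  where
  "caratheodory_solution J f x0 x \<longleftrightarrow>
     continuous_on J x \<and>
     (\<forall>t\<in>J. (\<lambda>s. f s (x s)) absolutely_integrable_on {0..t} \<and>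
             x t = x0 + integral {0..t} (\<lambda>s. f s (x s)))"

(* Controllability of the control system x' = A x + u b with scalar input u: every state can be
   steered to every other one in finite time by an integrable open-loop control. *)
definition controllable :: "real^'n^'n \<Rightarrow> real^'n \<Rightarrow> bool" where
  "controllable A b \<longleftrightarrow>
     (\<forall>x0 x1. \<exists>\<tau>\<ge>0. \<exists>u :: real \<Rightarrow> real. \<exists>x.
        u absolutely_integrable_on {0..\<tau>} \<and>
        caratheodory_solution {0..\<tau>} (\<lambda>t y. A *v y + u t *\<^sub>R b) x0 x \<and>
        x \<tau> = x1)"

(* Persistently exciting signals. They are functions on [0, \<infinity>), represented by total functions
   whose values at negative times are irrelevant. *)
definition PE_signals :: "real \<Rightarrow> real \<Rightarrow> (real \<Rightarrow> real) set" where
  "PE_signals T \<mu> =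
     {\<alpha>. \<alpha> \<in> borel_measurable (lebesgue_on {0..}) \<and>
         (\<forall>t\<ge>0. 0 \<le> \<alpha> t \<and> \<alpha> t \<le> 1) \<and>
         (\<forall>t\<ge>0. \<mu> \<le> integral {t..t+T} \<alpha>)}"

(* The ascription real^1^'n is needed: columnvector is polymorphic in its number of columns. *)
definition closed_loop :: "real^'n^'n \<Rightarrow> real^'n \<Rightarrow> real^'n \<Rightarrow> real \<Rightarrow> real^'n^'n" where
  "closed_loop A b K a = A - a *\<^sub>R ((columnvector b :: real^1^'n) ** rowvector K)"

(* The choice is legitimate: for persistently exciting signals a solution exists, and all solutions
   coincide on [0, \<infinity>); see trajectory_solution and trajectory_unique below. *)
definition trajectory ::
  "real^'n^'n \<Rightarrow> real^'n \<Rightarrow> real^'n \<Rightarrow> (real \<Rightarrow> real) \<Rightarrow> real^'n \<Rightarrow> real \<Rightarrow> real^'n" where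
  "trajectory A b K \<alpha> x0 =
     (SOME x. caratheodory_solution {0..} (\<lambda>t y. closed_loop A b K (\<alpha> t) *v y) x0 x)"

definition lambda_plus ::
  "real^'n^'n \<Rightarrow> real^'n \<Rightarrow> real^'n \<Rightarrow> (real \<Rightarrow> real) \<Rightarrow> ereal" where
  "lambda_plus A b K \<alpha> =
     (SUP x0\<in>{x0. norm x0 = 1}.
        Limsup at_top (\<lambda>t. ereal (ln (norm (trajectory A b K \<alpha> x0 t)) / t)))"

definition lambda_minus ::
  "real^'n^'n \<Rightarrow> real^'n \<Rightarrow> real^'n \<Rightarrow> (real \<Rightarrow> real) \<Rightarrow> ereal" where
  "lambda_minus A b K \<alpha> =
     (INF x0\<in>{x0. norm x0 = 1}.
        Liminf at_top (\<lambda>t. ereal (ln (norm (trajectory A b K \<alpha> x0 t)) / t)))"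

definition rc :: "real^'n^'n \<Rightarrow> real^'n \<Rightarrow> real \<Rightarrow> real \<Rightarrow> real^'n \<Rightarrow> ereal" where
  "rc A b T \<mu> K = - (SUP \<alpha>\<in>PE_signals T \<mu>. lambda_plus A b K \<alpha>)"

definition rd :: "real^'n^'n \<Rightarrow> real^'n \<Rightarrow> real \<Rightarrow> real \<Rightarrow> real^'n \<Rightarrow> ereal" where
  "rd A b T \<mu> K = (INF \<alpha>\<in>PE_signals T \<mu>. lambda_minus A b K \<alpha>)"

(* RC and RD are independent of b as long as (A, b) is controllable. Here b is kept as an
   argument, so that no choice of b and no appeal to this independence is needed. *)
definition RC :: "real^'n^'n \<Rightarrow> real^'n \<Rightarrow> real \<Rightarrow> real \<Rightarrow> ereal" where
  "RC A b T \<mu> = (SUP K. rc A b T \<mu> K)"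

definition RD :: "real^'n^'n \<Rightarrow> real^'n \<Rightarrow> real \<Rightarrow> real \<Rightarrow> ereal" where
  "RD A b T \<mu> = (SUP K. rd A b T \<mu> K)"

lemma closed_loop_bound:
  fixes A :: "real^'n^'n"
  obtains L where "L > 0"
    "\<And>a v. 0 \<le> a \<Longrightarrow> a \<le> 1 \<Longrightarrow> norm (closed_loop A b K a *v v) \<le> L * norm v"
proof -
  define B where "B = (columnvector b :: real^1^'n) ** rowvector K"
  obtain L1 where L1: "L1 > 0" "\<And>v. norm (A *v v) \<le> norm v * L1"
    using bounded_linear.pos_bounded[OF matrix_vector_mul_bounded_linear[of A]] by auto
  obtain L2 where L2: "L2 > 0" "\<And>v. norm (B *v v) \<le> norm v * L2"
    using bounded_linear.pos_bounded[OF matrix_vector_mul_bounded_linear[of B]] by auto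
  have "norm (closed_loop A b K a *v v) \<le> (L1 + L2) * norm v" if a: "0 \<le> a" "a \<le> 1" for a v
  proof -
    have "closed_loop A b K a *v v = A *v v - a *\<^sub>R (B *v v)"
      unfolding closed_loop_def B_def[symmetric]
      by (simp add: matrix_vector_mult_diff_rdistrib scaleR_matrix_vector_assoc)
    also have "norm \<dots> \<le> norm (A *v v) + \<bar>a\<bar> * norm (B *v v)"
      using norm_triangle_ineq4[of "A *v v" "a *\<^sub>R (B *v v)"] by simp
    also have "\<bar>a\<bar> * norm (B *v v) \<le> 1 * norm (B *v v)"
      using a by (intro mult_right_mono) auto
    finally show ?thesis using L1(2)[of v] L2(2)[of v] by (simp add: algebra_simps)
  qed
  with L1(1) L2(1) show thesis by (intro that[of "L1 + L2"]) auto
qed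

lemma closed_loop_absolutely_integrable:
  fixes A :: "real^'n^'n"
  assumes \<alpha>: "\<alpha> \<in> PE_signals T \<mu>" and y: "continuous_on {0..t} y"
  shows "(\<lambda>s. closed_loop A b K (\<alpha> s) *v y s) absolutely_integrable_on {0..t}"
proof -
  define B where "B = (columnvector b :: real^1^'n) ** rowvector K"
  have eq: "(\<lambda>s. closed_loop A b K (\<alpha> s) *v y s) = (\<lambda>s. A *v y s - \<alpha> s *\<^sub>R (B *v y s))"
    unfolding closed_loop_def B_def[symmetric]
    by (simp add: matrix_vector_mult_diff_rdistrib scaleR_matrix_vector_assoc)
  have cA: "continuous_on {0..t} (\<lambda>s. M *v y s)" for M :: "real^'n^'n"
    by (rule bounded_linear.continuous_on[OF matrix_vector_mul_bounded_linear y])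
  have ai: "(\<lambda>s. M *v y s) absolutely_integrable_on {0..t}" for M :: "real^'n^'n"
    by (rule absolutely_integrable_continuous_real[OF cA])
  have m: "\<alpha> \<in> borel_measurable (lebesgue_on {0..t})"
    by (rule measurable_restrict_mono[of \<alpha> lebesgue "{0..}"]) (use \<alpha> in \<open>auto simp: PE_signals_def\<close>)
  have bd: "bounded (\<alpha> ` {0..t})"
    unfolding bounded_iff using \<alpha> by (intro exI[of _ 1]) (auto simp: PE_signals_def)
  have "(\<lambda>s. \<alpha> s *\<^sub>R (B *v y s)) absolutely_integrable_on {0..t}"
    by (rule absolutely_integrable_bounded_measurable_product[OF _ m _ bd ai])
       (simp_all add: bounded_bilinear_scaleR bilinear_conv_bounded_bilinear)
  with ai[of A] show ?thesis unfolding eq by (rule set_integral_diff(1))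
qed

lemma weighted_integral_bound:
  fixes A :: "real^'n^'n"
  assumes \<alpha>: "\<alpha> \<in> PE_signals T \<mu>" and y: "continuous_on {0..t} y" and t: "0 \<le> t"
    and L: "L > 0" "\<And>a v. 0 \<le> a \<Longrightarrow> a \<le> 1 \<Longrightarrow> norm (closed_loop A b K a *v v) \<le> L * norm v"
    and d: "\<And>s. s \<in> {0..t} \<Longrightarrow> norm (y s) \<le> d * exp (2 * L * s)"
  shows "norm (integral {0..t} (\<lambda>s. closed_loop A b K (\<alpha> s) *v y s)) \<le> d / 2 * exp (2 * L * t)"
proof -
  have d0: "d \<ge> 0" using order_trans[OF norm_ge_zero d[of 0]] t by simp
  have I: "((\<lambda>s. L * d * exp (2 * L * s)) has_integral
             d / 2 * exp (2 * L * t) - d / 2 * exp (2 * L * 0)) {0..t}"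
    by (rule fundamental_theorem_of_calculus[OF t])
       (auto intro!: derivative_eq_intros
             simp flip: has_real_derivative_iff_has_vector_derivative)
  have "norm (integral {0..t} (\<lambda>s. closed_loop A b K (\<alpha> s) *v y s))
          \<le> integral {0..t} (\<lambda>s. L * d * exp (2 * L * s))"
  proof (rule integral_norm_bound_integral)
    show "(\<lambda>s. closed_loop A b K (\<alpha> s) *v y s) integrable_on {0..t}"
      using closed_loop_absolutely_integrable[OF \<alpha> y]
      by (rule set_lebesgue_integral_eq_integral(1))
    show "(\<lambda>s. L * d * exp (2 * L * s)) integrable_on {0..t}" using I by blast
    fix s assume s: "s \<in> {0..t}"
    have "norm (closed_loop A b K (\<alpha> s) *v y s) \<le> L * norm (y s)"
      using \<alpha> s by (intro L) (auto simp: PE_signals_def)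
    also have "\<dots> \<le> L * (d * exp (2 * L * s))"
      using d[OF s] L(1) by (intro mult_left_mono) auto
    finally show "norm (closed_loop A b K (\<alpha> s) *v y s) \<le> L * d * exp (2 * L * s)" by simp
  qed
  also have "\<dots> = d / 2 * exp (2 * L * t) - d / 2" using integral_unique[OF I] by simp
  finally show ?thesis using d0 by simp
qed

lemma trajectory_exists:
  fixes A :: "real^'n^'n"
  assumes \<alpha>: "\<alpha> \<in> PE_signals T \<mu>"
  shows "\<exists>x. caratheodory_solution {0..} (\<lambda>t y. closed_loop A b K (\<alpha> t) *v y) x0 x"
proof -
  obtain L where L: "L > 0"
    "\<And>a v. 0 \<le> a \<Longrightarrow> a \<le> 1 \<Longrightarrow> norm (closed_loop A b K a *v v) \<le> L * norm v"
    using closed_loop_bound by blast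
  define E where "E s = exp (2 * L * s)" for s
  define M where "M s = closed_loop A b K (\<alpha> s)" for s
  define J where "J w t = integral {0..t} (\<lambda>s. M s *v (E s *\<^sub>R w s))" for w :: "real \<Rightarrow> real^'n" and t
  define F where "F w t = inverse (E (max 0 t)) *\<^sub>R (x0 + J w (max 0 t))"
    for w :: "real \<Rightarrow> real^'n" and t
  have E: "E s > 0" for s by (simp add: E_def)
  have rescale: "norm (inverse (E s) *\<^sub>R v) \<le> d" if "norm v \<le> d * E s" for s d and v :: "real^'n"
    using that pos_divide_le_eq[OF E, of "norm v" s d] E[of s] by (simp add: divide_inverse_commute)
  have contE: "continuous_on S E" for S unfolding E_def by (intro continuous_intros)
  have cont: "continuous_on {0..t} (\<lambda>s. E s *\<^sub>R w s)" if "continuous_on UNIV w"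
    for t and w :: "real \<Rightarrow> real^'n"
    by (intro continuous_on_scaleR contE continuous_on_subset[OF that]) simp
  have ai: "(\<lambda>s. M s *v (E s *\<^sub>R w s)) absolutely_integrable_on {0..t}" if "continuous_on UNIV w"
    for t and w :: "real \<Rightarrow> real^'n"
    unfolding M_def by (rule closed_loop_absolutely_integrable[OF \<alpha> cont[OF that]])
  have contJ: "continuous_on {0..} (J w)" if w: "continuous_on UNIV w" for w
  proof -
    have "continuous_on {0..<real N} (J w)" for N
      unfolding J_def
      using indefinite_integral_continuous_1[OF set_lebesgue_integral_eq_integral(1)[OF ai[OF w, of "real N"]]]
      by (rule continuous_on_subset) auto
    hence *: "continuous (at t within {0..<real N}) (J w)" if "t \<in> {0..<real N}" for N t
      using that by (simp add: continuous_on_eq_continuous_within)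
    show ?thesis
      unfolding continuous_on_eq_continuous_within
    proof
      fix t :: real assume t: "t \<in> {0..}"
      obtain N where N: "t < real N" using reals_Archimedean2 by blast
      have "at t within {0..<real N} = at t within {0..}"
        by (rule at_within_nhd[of t "{..<real N}"]) (use N in auto)
      with *[of t N] t N show "continuous (at t within {0..}) (J w)" by auto
    qed
  qed
  have boundJ: "norm (J w t) \<le> d / 2 * E t"
    if "continuous_on UNIV w" "0 \<le> t" "\<And>s. norm (w s) \<le> d" for w t d
    unfolding J_def M_def E_def
  proof (rule weighted_integral_bound[OF \<alpha> cont[OF that(1), unfolded E_def] that(2) L])
    fix s show "norm (exp (2 * L * s) *\<^sub>R w s) \<le> d * exp (2 * L * s)"
      using that(3)[of s] by simp
  qed
  have Fb: "F (apply_bcontfun w) \<in> bcontfun" for w :: "real \<Rightarrow>\<^sub>C (real^'n)"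
  proof (rule bcontfun_normI)
    have cJ: "continuous_on UNIV (\<lambda>t. J w (max 0 t))"
      by (rule continuous_on_compose2[OF contJ]) (auto intro!: continuous_intros)
    show "continuous_on UNIV (F (apply_bcontfun w))"
      unfolding F_def using E cJ
      by (intro continuous_intros) (auto simp: E_def less_imp_neq[symmetric] intro!: continuous_intros)
    fix t :: real
    let ?t = "max 0 t"
    have "norm (J w ?t) \<le> norm w / 2 * E ?t"
      by (rule boundJ) (auto simp: norm_bounded)
    hence "norm (x0 + J w ?t) \<le> norm x0 + norm w / 2 * E ?t"
      using norm_triangle_ineq[of x0 "J w ?t"] by linarith
    also have "\<dots> \<le> (norm x0 + norm w / 2) * E ?t"
      using L(1) by (simp add: E_def distrib_right mult_le_cancel_left1)
    finally show "norm (F (apply_bcontfun w) t) \<le> norm x0 + norm w / 2"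
      unfolding F_def by (rule rescale)
  qed
  define \<Phi> where "\<Phi> w = Bcontfun (F (apply_bcontfun w))" for w :: "real \<Rightarrow>\<^sub>C (real^'n)"
  have \<Phi>: "apply_bcontfun (\<Phi> w) = F (apply_bcontfun w)" for w
    unfolding \<Phi>_def by (rule Bcontfun_inverse[OF Fb])
  have contr: "dist (\<Phi> w) (\<Phi> z) \<le> 1 / 2 * dist w z" for w z
  proof (rule dist_bound)
    fix t :: real
    let ?t = "max 0 t"
    have "J w ?t - J z ?t = J (\<lambda>s. w s - z s) ?t"
      unfolding J_def
      by (subst Henstock_Kurzweil_Integration.integral_diff[symmetric])
         (auto intro!: set_lebesgue_integral_eq_integral(1)[OF ai]
               simp: matrix_vector_mult_diff_distrib scaleR_diff_right)
    moreover have "norm (J (\<lambda>s. w s - z s) ?t) \<le> dist w z / 2 * E ?t"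
      by (rule boundJ) (auto intro!: continuous_intros simp: dist_bounded simp flip: dist_norm)
    moreover have "F w t - F z t = inverse (E ?t) *\<^sub>R (J w ?t - J z ?t)"
      unfolding F_def by (simp add: algebra_simps)
    ultimately have "norm (F w t - F z t) \<le> dist w z / 2"
      using rescale[of "J w ?t - J z ?t" "dist w z / 2" ?t] by presburger
    thus "dist (apply_bcontfun (\<Phi> w) t) (apply_bcontfun (\<Phi> z) t) \<le> 1 / 2 * dist w z"
      unfolding \<Phi> by (simp add: dist_norm[of "F w t"])
  qed
  obtain w where w: "\<Phi> w = w"
    using banach_fix_type[of "1 / 2" \<Phi>] contr by auto
  define x where "x t = E t *\<^sub>R w t" for t
  have wF: "w t = F w t" for t using \<Phi>[of w] by (simp add: w)
  have "caratheodory_solution {0..} (\<lambda>t y. closed_loop A b K (\<alpha> t) *v y) x0 x"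
    unfolding caratheodory_solution_def
  proof (intro conjI ballI)
    show "continuous_on {0..} x"
      unfolding x_def by (intro continuous_intros contE) simp
    fix t :: real assume t: "t \<in> {0..}"
    show "(\<lambda>s. closed_loop A b K (\<alpha> s) *v x s) absolutely_integrable_on {0..t}"
      using ai[of w t] unfolding M_def x_def by simp
    have "x t = x0 + J w t"
      unfolding x_def using t E[of t] by (subst wF) (simp add: F_def)
    thus "x t = x0 + integral {0..t} (\<lambda>s. closed_loop A b K (\<alpha> s) *v x s)"
      unfolding J_def M_def x_def .
  qed
  thus ?thesis by blast
qed

lemma trajectory_solution:
  fixes A :: "real^'n^'n"
  assumes "\<alpha> \<in> PE_signals T \<mu>"
  shows "caratheodory_solution {0..} (\<lambda>t y. closed_loop A b K (\<alpha> t) *v y) x0 (trajectory A b K \<alpha> x0)"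
  unfolding trajectory_def by (rule someI_ex[OF trajectory_exists[OF assms]])

lemma trajectory_unique:
  fixes A :: "real^'n^'n"
  assumes \<alpha>: "\<alpha> \<in> PE_signals T \<mu>" and t: "0 \<le> t"
    and x: "caratheodory_solution {0..} (\<lambda>t y. closed_loop A b K (\<alpha> t) *v y) x0 x"
  shows "x t = trajectory A b K \<alpha> x0 t"
proof -
  obtain L where L: "L > 0"
    "\<And>a v. 0 \<le> a \<Longrightarrow> a \<le> 1 \<Longrightarrow> norm (closed_loop A b K a *v v) \<le> L * norm v"
    using closed_loop_bound by blast
  define z where "z = trajectory A b K \<alpha> x0"
  have z: "caratheodory_solution {0..} (\<lambda>t y. closed_loop A b K (\<alpha> t) *v y) x0 z"
    unfolding z_def by (rule trajectory_solution[OF \<alpha>])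
  define y where "y s = x s - z s" for s
  have y: "continuous_on {0..r} y" for r
    using x z unfolding y_def caratheodory_solution_def
    by (intro continuous_on_diff) (auto elim!: continuous_on_subset)
  have yI: "y r = integral {0..r} (\<lambda>s. closed_loop A b K (\<alpha> s) *v y s)" if "r \<ge> 0" for r
  proof -
    have "(\<lambda>s. closed_loop A b K (\<alpha> s) *v x s) integrable_on {0..r}"
      "(\<lambda>s. closed_loop A b K (\<alpha> s) *v z s) integrable_on {0..r}"
      using x z that
      by (auto simp: caratheodory_solution_def intro!: set_lebesgue_integral_eq_integral(1))
    moreover have "x r = x0 + integral {0..r} (\<lambda>s. closed_loop A b K (\<alpha> s) *v x s)"
      "z r = x0 + integral {0..r} (\<lambda>s. closed_loop A b K (\<alpha> s) *v z s)"
      using x z that by (auto simp: caratheodory_solution_def)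
    ultimately show ?thesis
      by (simp add: y_def matrix_vector_mult_diff_distrib
          Henstock_Kurzweil_Integration.integral_diff)
  qed
  define g where "g s = norm (y s) * exp (- (2 * L * s))" for s
  have "continuous_on {0..t} g" unfolding g_def by (intro continuous_intros y)
  then obtain r where r: "r \<in> {0..t}" "\<And>s. s \<in> {0..t} \<Longrightarrow> g s \<le> g r"
    using continuous_attains_sup[of "{0..t}" g] t by auto
  have "norm (y r) \<le> g r / 2 * exp (2 * L * r)"
    unfolding yI[of r, OF atLeastAtMost_iff[THEN iffD1, OF r(1), THEN conjunct1]]
  proof (rule weighted_integral_bound[OF \<alpha> y _ L])
    fix s assume "s \<in> {0..r}"
    with r have "g s \<le> g r" by auto
    thus "norm (y s) \<le> g r * exp (2 * L * s)"
      by (simp add: g_def exp_minus field_simps)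
  qed (use r in auto)
  hence "g r \<le> g r / 2" by (simp add: g_def exp_minus field_simps)
  hence "g t \<le> 0" using r(2)[of t] t by simp
  hence "y t = 0" by (simp add: g_def mult_le_0_iff)
  thus ?thesis by (simp add: y_def z_def)
qed

end

theory Submission
  imports Defs
begin

text \<open>
  For large \<open>\<gamma>\<close> the Lyapunov equation \<open>A W + W A\<^sup>T + \<gamma> W = b b\<^sup>T\<close> has a unique solution, which is
  positive definite because \<open>(A, b)\<close> is controllable. With \<open>P = W\<^sup>-\<^sup>1\<close> and the feedback \<open>K = P b\<close>, the
  form \<open>V = x\<^sup>T P x\<close> satisfies
  \<open>V' = - \<gamma> V + (1 - 2 \<alpha>) (b\<^sup>T P x)\<^sup>2 \<le> (- \<gamma> + 2 (1 - \<alpha>) b\<^sup>T P b) V\<close>, and taking the trace of the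
  Lyapunov equation multiplied by \<open>P\<close> gives \<open>b\<^sup>T P b = 2 tr A + n \<gamma>\<close>. Since \<open>1 - \<alpha>\<close> has mean at
  most \<open>1 - \<rho>\<close>, \<open>V\<close> decays at rate at least \<open>\<gamma> (1 - 2 n (1 - \<rho>)) - 4 (1 - \<rho>) tr A\<close>, which is
  unbounded in \<open>\<gamma>\<close> as soon as \<open>\<rho> > 1 - 1 / (2 n)\<close>. Divergence is the same estimate for
  \<open>(- A, - K)\<close>.
\<close>

section \<open>The closed loop matrix and degenerate vectors of semidefinite forms\<close>

lemma closed_loop_mult:
  fixes A :: "real^'n^'n"
  shows "closed_loop A b K a *v x = A *v x - (a * (K \<bullet> x)) *\<^sub>R b"
  unfolding closed_loop_def
  by (simp add: vec_eq_iff matrix_vector_mult_def matrix_matrix_mult_def columnvector_def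
      rowvector_def inner_vec_def sum_subtractf sum_distrib_left algebra_simps)

lemma uminus_matrix_vector_mult: "(- A) *v x = - (A *v x)" for A :: "real^'n^'m"
  by (simp add: vec_eq_iff matrix_vector_mult_def sum_negf)

text \<open>This symmetry reduces divergence for \<open>A\<close> to convergence for
  \<open>- A\<close>: a feedback that makes the system of \<open>- A\<close> decay yields, up to
  sign, one that makes the system of \<open>A\<close> grow.\<close>

lemma closed_loop_uminus: "closed_loop (- A) b (- K) a *v x = - (closed_loop A b K a *v x)"
  by (simp add: closed_loop_mult uminus_matrix_vector_mult)

text \<open>If \<open>u = S *v v\<close> were nonzero, the form at \<open>v + t *\<^sub>R u\<close>
  would have the first order term \<open>2 * t * (u \<bullet> u)\<close> and no constant term, hence
  would be negative for small negative \<open>t\<close>.\<close>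

lemma psd_kernel:
  fixes S :: "real^'n^'n"
  assumes sym: "transpose S = S" and psd: "\<And>v. 0 \<le> v \<bullet> (S *v v)" and v: "v \<bullet> (S *v v) = 0"
  shows "S *v v = 0"
proof -
  define u where "u = S *v v"
  have sw: "v \<bullet> (S *v u) = u \<bullet> u"
    using dot_lmul_matrix[of v S u] transpose_matrix_vector[of S v] sym by (simp add: u_def)
  have *: "0 \<le> 2 * t * (u \<bullet> u) + t\<^sup>2 * (u \<bullet> (S *v u))" for t
    using psd[of "v + t *\<^sub>R u"] v sw
    by (simp add: matrix_vector_right_distrib matrix_vector_mult_scaleR inner_add_left
        inner_add_right u_def[symmetric] power2_eq_square inner_commute algebra_simps)
  define q where "q = u \<bullet> (S *v u)"
  have q: "q \<ge> 0" using psd q_def by auto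
  show ?thesis
  proof (rule ccontr)
    assume "\<not> ?thesis"
    hence uu: "u \<bullet> u > 0" by (simp add: u_def)
    \<comment> \<open>The summand 1 keeps the denominator positive when \<open>q = 0\<close>. The
      inequality above is then used at \<open>- t\<close>.\<close>
    define t where "t = (u \<bullet> u) / (q + 1)"
    have t: "t > 0" "t * q \<le> u \<bullet> u"
      using uu q by (auto simp: t_def field_simps)
    have "0 \<le> t * (t * q - 2 * (u \<bullet> u))"
      using *[of "- t"] by (simp add: q_def power2_eq_square algebra_simps)
    hence "0 \<le> t * q - 2 * (u \<bullet> u)" using t(1) by (simp add: zero_le_mult_iff)
    thus False using t uu by linarith
  qed
qed

section \<open>The Lyapunov equation: solvability and semidefiniteness of the solution\<close>

lemma inner_mult_transpose:
  fixes X F :: "real^'n^'n"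
  shows "X \<bullet> (X ** transpose F) = (\<Sum>i\<in>UNIV. X $ i \<bullet> (F *v X $ i))"
  by (simp add: inner_vec_def matrix_matrix_mult_def matrix_vector_mult_def transpose_def mult_ac)

lemma inner_transpose:
  fixes X Y :: "real^'n^'n"
  shows "transpose X \<bullet> transpose Y = X \<bullet> Y"
  unfolding inner_vec_def by (subst (2) sum.swap) (simp add: transpose_def)

text \<open>The Lyapunov operator is linear on a finite-dimensional space, so injectivity gives
  surjectivity. It is injective because its entrywise inner product with \<open>X\<close> is
  positive for nonzero \<open>X\<close>: row by row, this is the positivity of \<open>F\<close>. As
  the operator commutes with transposition, uniqueness makes the solution for a symmetric right-hand
  side symmetric.\<close>

lemma lyapunov_equation_solvable:
  fixes F Q :: "real^'n^'n"
  assumes F: "\<And>v. v \<noteq> 0 \<Longrightarrow> 0 < v \<bullet> (F *v v)" and Q: "transpose Q = Q"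
  obtains W where "transpose W = W" "F ** W + W ** transpose F = Q"
proof -
  define \<L> where "\<L> X = F ** X + X ** transpose F" for X
  have lin: "linear \<L>"
    by (rule linearI)
       (simp_all add: \<L>_def vec_eq_iff matrix_matrix_mult_def sum.distrib sum_distrib_left
          algebra_simps)
  have pos: "0 < X \<bullet> (X ** transpose F)" if "X \<noteq> 0" for X :: "real^'n^'n"
  proof -
    have ge: "0 \<le> X $ i \<bullet> (F *v X $ i)" for i
      using F[of "X $ i"] by (cases "X $ i = 0") auto
    have "\<exists>i. X $ i \<noteq> 0" using that by (simp add: vec_eq_iff[of X 0])
    then obtain i where "X $ i \<noteq> 0" ..
    with F have "0 < X $ i \<bullet> (F *v X $ i)" by blast
    thus ?thesis
      unfolding inner_mult_transpose using ge by (intro sum_pos2[of UNIV i]) auto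
  qed
  have tr: "transpose (\<L> X) = \<L> (transpose X)" for X
  proof -
    have "transpose (Y + Z) = transpose Y + transpose Z" for Y Z :: "real^'n^'n"
      by (simp add: transpose_def vec_eq_iff)
    thus ?thesis by (simp add: \<L>_def matrix_transpose_mul add.commute)
  qed
  have "X = 0" if "\<L> X = 0" for X
  proof (rule ccontr)
    assume X: "X \<noteq> 0"
    hence "transpose X \<noteq> 0" by (auto simp: vec_eq_iff transpose_def)
    \<comment> \<open>Transposition turns left multiplication by \<open>F\<close> into right
      multiplication by its transpose, so \<open>pos\<close> covers both summands.\<close>
    moreover have "X \<bullet> (F ** X) = transpose X \<bullet> (transpose X ** transpose F)"
      by (simp flip: inner_transpose[of X] add: matrix_transpose_mul)
    ultimately have "0 < X \<bullet> \<L> X"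
      using pos[OF X] pos[of "transpose X"] by (simp add: \<L>_def inner_add_right)
    with that show False by simp
  qed
  hence inj: "inj \<L>" by (simp add: linear_injective_0[OF lin])
  then obtain W where W: "\<L> W = Q"
    using linear_injective_imp_surjective[OF lin] by (metis surjD)
  have "\<L> (transpose W) = \<L> W" using tr[of W] W Q by simp
  hence "transpose W = W" using inj by (simp add: inj_eq)
  with W that show thesis by (simp add: \<L>_def)
qed

lemma inner_lyapunov:
  fixes F W :: "real^'n^'n"
  assumes "transpose W = W"
  shows "v \<bullet> ((F ** W + W ** transpose F) *v v) = 2 * (v \<bullet> (F *v (W *v v)))"
proof -
  have "v \<bullet> (W *v (transpose F *v v)) = v \<bullet> (F *v (W *v v))"
    using dot_lmul_matrix[of v W "v v* F"] dot_lmul_matrix[of v F "W *v v"] transpose_matrix_vector[of W v]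
    by (simp add: assms inner_commute)
  thus ?thesis
    by (simp add: matrix_vector_mult_add_rdistrib inner_add_right matrix_vector_mul_assoc[symmetric])
qed

text \<open>The Rayleigh quotient attains its minimum on the compact unit sphere. This serves twice:
  to find a lowest eigenvector of \<open>W\<close>, and to bound the norm by the form of
  \<open>P\<close>.\<close>

lemma quadratic_form_minimizer:
  fixes W :: "real^'n^'n"
  obtains e where "norm e = 1" "\<And>v. (e \<bullet> (W *v e)) * (v \<bullet> v) \<le> v \<bullet> (W *v v)"
proof -
  have "\<exists>e\<in>sphere 0 1. \<forall>y\<in>sphere 0 1. e \<bullet> (W *v e) \<le> y \<bullet> (W *v y)"
  proof (rule continuous_attains_inf)
    show "sphere (0::real^'n) 1 \<noteq> {}" by simp
    show "continuous_on (sphere 0 1) (\<lambda>v. v \<bullet> (W *v v))"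
      by (intro continuous_intros matrix_vector_mult_linear_continuous_on)
  qed simp
  then obtain e where e: "norm e = 1" and min: "\<And>y. norm y = 1 \<Longrightarrow> e \<bullet> (W *v e) \<le> y \<bullet> (W *v y)"
    by auto
  have "(e \<bullet> (W *v e)) * (v \<bullet> v) \<le> v \<bullet> (W *v v)" for v
  proof (cases "v = 0")
    case False
    have "e \<bullet> (W *v e) \<le> (v /\<^sub>R norm v) \<bullet> (W *v (v /\<^sub>R norm v))"
      by (rule min) (simp add: False)
    also have "\<dots> = (v \<bullet> (W *v v)) / (norm v)\<^sup>2"
      by (simp add: matrix_vector_mult_scaleR power2_eq_square divide_inverse)
    finally show ?thesis using False by (simp add: power2_norm_eq_inner field_simps)
  qed simp
  with e show thesis by (rule that)
qed

text \<open>At a lowest eigenvector the Lyapunov equation forces the eigenvalue to be nonnegative.\<close>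

lemma lyapunov_psd:
  fixes F W :: "real^'n^'n"
  assumes F: "\<And>v. v \<noteq> 0 \<Longrightarrow> 0 < v \<bullet> (F *v v)" and W: "transpose W = W"
    and Q: "\<And>v. 0 \<le> v \<bullet> ((F ** W + W ** transpose F) *v v)"
  shows "0 \<le> v \<bullet> (W *v v)"
proof -
  obtain e where e: "norm e = 1" and min: "\<And>v. (e \<bullet> (W *v e)) * (v \<bullet> v) \<le> v \<bullet> (W *v v)"
    using quadratic_form_minimizer by blast
  define l where "l = e \<bullet> (W *v e)"
  note ge = min[folded l_def]
  \<comment> \<open>Subtracting the minimum \<open>l\<close> leaves a semidefinite matrix whose form
    vanishes at \<open>e\<close>. By \<open>psd_kernel\<close> it annihilates \<open>e\<close>, so
    that \<open>e\<close> is an eigenvector of \<open>W\<close> for \<open>l\<close>.\<close>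
  define S where "S = W - mat l"
  have mat: "mat l *v v = l *\<^sub>R v" for v :: "real^'n"
    by (simp add: vec_eq_iff matrix_vector_mult_def mat_def if_distrib if_distribR cong: if_cong)
  have Sv: "S *v v = W *v v - l *\<^sub>R v" for v
    by (simp add: S_def matrix_vector_mult_diff_rdistrib mat)
  have "S *v e = 0"
  proof (rule psd_kernel)
    show "transpose S = S"
      using W by (simp add: S_def vec_eq_iff transpose_def mat_def)
    show "0 \<le> v \<bullet> (S *v v)" for v using ge[of v] by (simp add: Sv inner_diff_right)
    show "e \<bullet> (S *v e) = 0"
      using e by (simp add: Sv inner_diff_right l_def norm_eq_1)
  qed
  hence We: "W *v e = l *\<^sub>R e" by (simp add: Sv)
  have "0 \<le> 2 * l * (e \<bullet> (F *v e))"
    using Q[of e] unfolding inner_lyapunov[OF W] We by (simp add: matrix_vector_mult_scaleR)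
  moreover have "0 < e \<bullet> (F *v e)" using F[of e] e by (metis norm_zero zero_neq_one)
  ultimately have "0 \<le> l" by (simp add: zero_le_mult_iff)
  thus ?thesis using ge[of v] by (smt (verit) inner_ge_zero mult_nonneg_nonneg)
qed

section \<open>Controllability in dual form: no nonzero vectors orthogonal to \<open>b\<close> along
  their orbits\<close>

lemma has_integral_exp_weight:
  fixes L t :: real
  assumes "0 \<le> t"
  shows "((\<lambda>s. L * d * exp (2 * L * s)) has_integral (d / 2 * exp (2 * L * t) - d / 2)) {0..t}"
proof -
  have "((\<lambda>s. L * d * exp (2 * L * s)) has_integral
             d / 2 * exp (2 * L * t) - d / 2 * exp (2 * L * 0)) {0..t}"
    by (rule fundamental_theorem_of_calculus[OF assms])
       (auto intro!: derivative_eq_intros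
             simp flip: has_real_derivative_iff_has_vector_derivative)
  thus ?thesis by simp
qed

text \<open>The trajectories issued from the origin are orthogonal to \<open>N\<close>: the exponentially
  weighted bound below can be halved indefinitely.\<close>

lemma controllable_invariant_trivial:
  fixes A :: "real^'n^'n"
  assumes ctrl: "controllable A b"
    and N: "\<And>v. v \<in> N \<Longrightarrow> b \<bullet> v = 0" "\<And>v. v \<in> N \<Longrightarrow> transpose A *v v \<in> N"
    and v: "v \<in> N"
  shows "v = 0"
proof -
  \<comment> \<open>The origin is steered to \<open>v\<close> itself, so a bound on
    \<open>v \<bullet> x \<tau>\<close> is a bound on \<open>v \<bullet> v\<close>.\<close>
  obtain \<tau> u x where \<tau>: "\<tau> \<ge> 0" and u: "u absolutely_integrable_on {0..\<tau>}"
    and x: "caratheodory_solution {0..\<tau>} (\<lambda>t y. A *v y + u t *\<^sub>R b) 0 x" and xv: "x \<tau> = v"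
    using ctrl unfolding controllable_def by blast
  have cx: "continuous_on {0..\<tau>} x" using x by (simp add: caratheodory_solution_def)
  \<comment> \<open>Since \<open>w\<close> is orthogonal to \<open>b\<close>, the control drops out
    of the equation for \<open>w \<bullet> x t\<close>.\<close>
  have int: "w \<bullet> x t = integral {0..t} (\<lambda>s. (transpose A *v w) \<bullet> x s)"
    if w: "w \<in> N" and t: "t \<in> {0..\<tau>}" for w t
  proof -
    have i: "(\<lambda>s. A *v x s + u s *\<^sub>R b) integrable_on {0..t}"
      and e: "x t = integral {0..t} (\<lambda>s. A *v x s + u s *\<^sub>R b)"
      using x t unfolding caratheodory_solution_def
      by (auto intro: set_lebesgue_integral_eq_integral(1))
    have "w \<bullet> x t = integral {0..t} (\<lambda>s. w \<bullet> (A *v x s + u s *\<^sub>R b))"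
      unfolding e using integral_linear[OF i bounded_linear_inner_right[of w]] by (simp add: o_def)
    also have "(\<lambda>s. w \<bullet> (A *v x s + u s *\<^sub>R b)) = (\<lambda>s. (transpose A *v w) \<bullet> x s)"
      using N(1)[OF w]
      by (simp add: inner_add_right inner_commute[of w b] transpose_matrix_vector dot_lmul_matrix)
    finally show ?thesis .
  qed
  obtain L where L: "L > 0" "\<And>v. norm (transpose A *v v) \<le> norm v * L"
    using bounded_linear.pos_bounded[OF matrix_vector_mul_bounded_linear[of "transpose A"]] by auto
  obtain M where M: "M > 0" "\<And>s. s \<in> {0..\<tau>} \<Longrightarrow> norm (x s) \<le> M"
    using compact_imp_bounded[OF compact_continuous_image[OF cx]] unfolding bounded_pos by auto
  \<comment> \<open>The bound is claimed for all \<open>w\<close> in \<open>N\<close> at once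
    because the induction passes from \<open>w\<close> to \<open>transpose A *v w\<close>. This
    costs a factor \<open>L\<close>, while integrating \<open>exp (2 * L * s)\<close> gains a factor
    \<open>1 / (2 * L)\<close>; the product is one half.\<close>
  have step: "\<bar>w \<bullet> x t\<bar> \<le> M / 2 ^ k * norm w * exp (2 * L * t)" if "w \<in> N" "t \<in> {0..\<tau>}" for w t k
    using that
  proof (induction k arbitrary: w t)
    case 0
    have "\<bar>w \<bullet> x t\<bar> \<le> norm w * norm (x t)" by (rule Cauchy_Schwarz_ineq2)
    also have "\<dots> \<le> norm w * M" using M(2)[OF 0(2)] by (intro mult_left_mono) auto
    also have "\<dots> * 1 \<le> norm w * M * exp (2 * L * t)"
      using M(1) L(1) 0(2) by (intro mult_left_mono) auto
    finally show ?case by (simp add: mult_ac)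
  next
    case (Suc k)
    define d where "d = M / 2 ^ k * norm w"
    have d: "d \<ge> 0" using M(1) by (simp add: d_def)
    have t: "0 \<le> t" using Suc.prems by simp
    note I = has_integral_exp_weight[OF t, of L d]
    have "norm (integral {0..t} (\<lambda>s. (transpose A *v w) \<bullet> x s))
            \<le> integral {0..t} (\<lambda>s. L * d * exp (2 * L * s))"
    proof (rule integral_norm_bound_integral)
      show "(\<lambda>s. (transpose A *v w) \<bullet> x s) integrable_on {0..t}"
        by (intro integrable_continuous_interval continuous_intros continuous_on_subset[OF cx])
           (use Suc.prems in auto)
      show "(\<lambda>s. L * d * exp (2 * L * s)) integrable_on {0..t}" using I by blast
      fix s assume s: "s \<in> {0..t}"
      have "\<bar>(transpose A *v w) \<bullet> x s\<bar> \<le> M / 2 ^ k * norm (transpose A *v w) * exp (2 * L * s)"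
        using s Suc.prems by (intro Suc.IH N(2)) auto
      also have "\<dots> \<le> M / 2 ^ k * (norm w * L) * exp (2 * L * s)"
        using L(2)[of w] M(1) by (intro mult_right_mono mult_left_mono) auto
      finally show "norm ((transpose A *v w) \<bullet> x s) \<le> L * d * exp (2 * L * s)"
        by (simp add: d_def mult_ac)
    qed
    also have "\<dots> \<le> d / 2 * exp (2 * L * t)" using integral_unique[OF I] d by simp
    finally show ?case by (simp add: int[OF Suc.prems] d_def mult_ac)
  qed
  have "(\<lambda>k. M * norm v * exp (2 * L * \<tau>) * (1 / 2) ^ k) \<longlonglongrightarrow> M * norm v * exp (2 * L * \<tau>) * 0"
    by (intro tendsto_mult tendsto_const LIMSEQ_realpow_zero) auto
  moreover have "\<forall>k\<ge>0. \<bar>v \<bullet> v\<bar> \<le> M * norm v * exp (2 * L * \<tau>) * (1 / 2) ^ k"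
    using step[OF v, of \<tau>] \<tau> xv by (simp add: power_one_over field_simps)
  ultimately have "\<bar>v \<bullet> v\<bar> \<le> M * norm v * exp (2 * L * \<tau>) * 0"
    by (intro LIMSEQ_le_const) auto
  thus ?thesis by (metis abs_le_zero_iff inner_eq_zero_iff mult_zero_right)
qed

section \<open>The Lyapunov feedback and its decay estimate\<close>

lemma trace_add_transpose:
  fixes F W P :: "real^'n^'n"
  assumes "P ** W = mat 1" "W ** P = mat 1"
  shows "trace (P ** (F ** W + W ** transpose F)) = 2 * trace F"
proof -
  have "trace (P ** (F ** W)) = trace F"
    using trace_mul_sym[of P "F ** W"] assms by (simp add: matrix_mul_assoc[symmetric])
  moreover have "trace (P ** (W ** transpose F)) = trace F"
    using assms by (simp add: matrix_mul_assoc) (simp add: trace_def transpose_def)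
  ultimately show ?thesis by (simp add: matrix_add_ldistrib trace_add)
qed

text \<open>Controllability enters only through sets \<open>N\<close> orthogonal to \<open>b\<close>
  and stable under the transpose of \<open>A\<close>, a form that carries over easily to
  \<open>- A\<close>. The coefficient \<open>2 * trace A + \<gamma> * real CARD('n)\<close> is the
  value of \<open>b \<bullet> (P *v b)\<close>; knowing it exactly, with growth linear in
  \<open>\<gamma>\<close>, is what produces a threshold depending on the dimension alone.\<close>

lemma lyapunov_feedback:
  fixes A :: "real^'n^'n"
  assumes ctrl: "\<forall>N. (\<forall>v\<in>N. b \<bullet> v = 0 \<and> transpose A *v v \<in> N) \<longrightarrow> N \<subseteq> {0}"
  obtains \<gamma>0 where
    "\<And>\<gamma>. \<gamma>0 \<le> \<gamma> \<Longrightarrow> \<exists>P. (\<forall>v w. v \<bullet> (P *v w) = (P *v v) \<bullet> w) \<and> (\<forall>v. v \<noteq> 0 \<longrightarrow> 0 < v \<bullet> (P *v v)) \<and>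
       0 \<le> 2 * trace A + \<gamma> * real CARD('n) \<and>
       (\<forall>a x. a \<le> 1 \<longrightarrow> 2 * ((P *v x) \<bullet> (closed_loop A b (P *v b) a *v x))
          \<le> (- \<gamma> + 2 * (1 - a) * (2 * trace A + \<gamma> * real CARD('n))) * (x \<bullet> (P *v x)))"
proof -
  obtain L where L: "L > 0" "\<And>v. norm (A *v v) \<le> norm v * L"
    using bounded_linear.pos_bounded[OF matrix_vector_mul_bounded_linear[of A]] by auto
  show thesis
  \<comment> \<open>As \<open>L\<close> bounds the norm of \<open>A\<close>, this choice gives
    \<open>\<gamma> / 2 - L \<ge> 1\<close>, which makes the shifted matrix \<open>F\<close>
    positive.\<close>
  proof (rule that[of "2 * (L + 1)"])
    fix \<gamma> :: real assume \<gamma>: "2 * (L + 1) \<le> \<gamma>"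
    define F where "F = A + mat (\<gamma> / 2)"
    have Fv: "F *v v = A *v v + (\<gamma> / 2) *\<^sub>R v" for v
      by (simp add: F_def matrix_vector_mult_add_rdistrib)
         (simp add: vec_eq_iff matrix_vector_mult_def mat_def if_distrib if_distribR cong: if_cong)
    have FTv: "transpose F *v v = transpose A *v v + (\<gamma> / 2) *\<^sub>R v" for v
    proof -
      have "transpose F = transpose A + mat (\<gamma> / 2)"
        by (simp add: F_def transpose_def mat_def vec_eq_iff)
      thus ?thesis
        by (simp add: matrix_vector_mult_add_rdistrib del: transpose_matrix_vector)
           (simp add: vec_eq_iff matrix_vector_mult_def mat_def if_distrib if_distribR cong: if_cong)
    qed
    have trF: "2 * trace F = 2 * trace A + \<gamma> * real CARD('n)"
      by (simp add: F_def trace_add) (simp add: trace_def mat_def)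
    have Fpos: "0 < v \<bullet> (F *v v)" if "v \<noteq> 0" for v
    proof -
      have "\<bar>v \<bullet> (A *v v)\<bar> \<le> norm v * (norm v * L)"
        using Cauchy_Schwarz_ineq2[of v "A *v v"] mult_left_mono[OF L(2)[of v], of "norm v"] by simp
      hence "v \<bullet> (F *v v) \<ge> (\<gamma> / 2 - L) * (norm v)\<^sup>2"
        by (simp add: Fv inner_add_right power2_norm_eq_inner[symmetric] power2_eq_square algebra_simps)
      moreover have "(\<gamma> / 2 - L) * (norm v)\<^sup>2 > 0" using \<gamma> that by simp
      ultimately show ?thesis by linarith
    qed
    define Q :: "real^'n^'n" where "Q = (\<chi> i j. b $ i * b $ j)"
    have Q: "transpose Q = Q" by (simp add: Q_def transpose_def vec_eq_iff mult.commute)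
    have Qv: "Q *v v = (b \<bullet> v) *\<^sub>R b" for v
      by (simp add: Q_def vec_eq_iff matrix_vector_mult_def inner_vec_def sum_distrib_left mult_ac)
    have trQ: "trace (M ** Q) = b \<bullet> (M *v b)" for M :: "real^'n^'n"
      by (simp add: Q_def trace_def matrix_matrix_mult_def matrix_vector_mult_def inner_vec_def
          sum_distrib_left mult_ac)
    obtain W where W: "transpose W = W" "F ** W + W ** transpose F = Q"
      using lyapunov_equation_solvable[OF Fpos Q] by blast
    have quad: "2 * (v \<bullet> (F *v (W *v v))) = (b \<bullet> v)\<^sup>2" for v
      using inner_lyapunov[OF W(1), of v F] unfolding W(2) Qv
      by (simp add: power2_eq_square inner_commute)
    have psd: "0 \<le> v \<bullet> (W *v v)" for v
      by (rule lyapunov_psd[OF Fpos W(1)]) (simp_all add: W(2) Qv inner_commute)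
    have ker: "v = 0" if "W *v v = 0" for v
    proof -
      \<comment> \<open>The kernel of \<open>W\<close> is such a set \<open>N\<close>: for
        \<open>v\<close> in it, \<open>quad\<close> gives orthogonality to \<open>b\<close>, and the
        Lyapunov equation applied to \<open>v\<close> then leaves only
        \<open>W *v (transpose F *v v) = 0\<close>.\<close>
      have "\<forall>v\<in>{v. W *v v = 0}. b \<bullet> v = 0 \<and> transpose A *v v \<in> {v. W *v v = 0}"
      proof (intro ballI conjI)
        fix v assume "v \<in> {v. W *v v = 0}"
        hence v: "W *v v = 0" by simp
        show b: "b \<bullet> v = 0" using quad[of v] v by simp
        have "W *v (transpose F *v v) = 0"
          using arg_cong[OF W(2), of "\<lambda>M. M *v v"] v b
          by (simp add: Qv matrix_vector_mult_add_rdistrib flip: matrix_vector_mul_assoc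
              del: transpose_matrix_vector)
        thus "transpose A *v v \<in> {v. W *v v = 0}"
          using v unfolding FTv
          by (simp add: matrix_vector_right_distrib matrix_vector_mult_scaleR del: transpose_matrix_vector)
      qed
      with ctrl have "{v. W *v v = 0} \<subseteq> {0}" by blast
      with that show ?thesis by blast
    qed
    obtain P where PW: "P ** W = mat 1"
      using ker matrix_left_invertible_ker[of W] by blast
    hence WP: "W ** P = mat 1" by (simp add: matrix_left_right_inverse)
    have WPv: "W *v (P *v v) = v" for v by (simp add: matrix_vector_mul_assoc WP)
    have Wsym: "v \<bullet> (W *v w) = (W *v v) \<bullet> w" for v w
      using dot_lmul_matrix[of v W w] transpose_matrix_vector[of W v] W(1) by simp
    have Psym: "v \<bullet> (P *v w) = (P *v v) \<bullet> w" for v w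
      using Wsym[of "P *v v" "P *v w"] by (simp add: WPv)
    have Pge: "0 \<le> v \<bullet> (P *v v)" for v
      using psd[of "P *v v"] by (simp add: WPv inner_commute)
    have Ppos: "0 < v \<bullet> (P *v v)" if "v \<noteq> 0" for v
    proof -
      have "v \<bullet> (P *v v) \<noteq> 0"
      proof
        assume "v \<bullet> (P *v v) = 0"
        hence "W *v (P *v v) = 0"
          by (intro psd_kernel[OF W(1) psd]) (simp add: WPv inner_commute)
        with that show False by (simp add: WPv)
      qed
      with Pge[of v] show ?thesis by linarith
    qed
    have bPb: "b \<bullet> (P *v b) = 2 * trace A + \<gamma> * real CARD('n)"
      using trace_add_transpose[OF PW WP, of F] unfolding W(2) trQ trF .
    have CS: "((P *v b) \<bullet> x)\<^sup>2 \<le> (b \<bullet> (P *v b)) * (x \<bullet> (P *v x))" for x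
    proof (cases "b = 0")
      case False
      \<comment> \<open>Cauchy-Schwarz for the form of \<open>P\<close>, obtained by testing it on
        \<open>x\<close> minus its projection to \<open>b\<close>, scaled by \<open>p\<close> to
        avoid division.\<close>
      define p q r where "p = b \<bullet> (P *v b)" and "q = (P *v b) \<bullet> x" and "r = x \<bullet> (P *v x)"
      have p: "p > 0" using Ppos[OF False] by (simp add: p_def)
      have "0 \<le> (p *\<^sub>R x - q *\<^sub>R b) \<bullet> (P *v (p *\<^sub>R x - q *\<^sub>R b))" by (rule Pge)
      also have "\<dots> = p * p * r - 2 * p * q * q + q * q * p"
        using Psym[of b x]
        by (simp add: p_def q_def r_def matrix_vector_mult_diff_distrib matrix_vector_mult_scaleR
            inner_diff_left inner_diff_right inner_commute[of x "P *v b"] algebra_simps)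
      also have "\<dots> = p * (p * r - q\<^sup>2)" by (simp add: power2_eq_square algebra_simps)
      finally have "0 \<le> p * r - q\<^sup>2" using p by (simp add: zero_le_mult_iff)
      thus ?thesis by (simp add: p_def q_def r_def)
    qed simp
    have "2 * ((P *v x) \<bullet> (closed_loop A b (P *v b) a *v x))
          \<le> (- \<gamma> + 2 * (1 - a) * (b \<bullet> (P *v b))) * (x \<bullet> (P *v x))" if a: "a \<le> 1" for a x
    proof -
      have e: "2 * ((P *v x) \<bullet> (F *v x)) = ((P *v b) \<bullet> x)\<^sup>2"
        using quad[of "P *v x"] Psym[of b x] by (simp add: WPv)
      have "2 * ((P *v x) \<bullet> (closed_loop A b (P *v b) a *v x))
          = - \<gamma> * (x \<bullet> (P *v x)) + (1 - 2 * a) * ((P *v b) \<bullet> x)\<^sup>2"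
        using e Psym[of x b]
        by (simp add: closed_loop_mult Fv inner_diff_right inner_add_right inner_commute[of "P *v x" x]
            inner_commute[of x "P *v b"] power2_eq_square algebra_simps)
      \<comment> \<open>The coefficient \<open>1 - 2 * a\<close> may be negative. The larger one
        \<open>2 * (1 - a)\<close> is nonnegative, so Cauchy-Schwarz applies, and it vanishes when
        the signal is fully on.\<close>
      also have "(1 - 2 * a) * ((P *v b) \<bullet> x)\<^sup>2 \<le> 2 * (1 - a) * ((P *v b) \<bullet> x)\<^sup>2"
        by (intro mult_right_mono) auto
      also have "\<dots> \<le> 2 * (1 - a) * ((b \<bullet> (P *v b)) * (x \<bullet> (P *v x)))"
        using a CS by (intro mult_left_mono) auto
      finally show ?thesis by (simp add: algebra_simps)
    qed
    with Psym Ppos Pge[of b]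
    show "\<exists>P. (\<forall>v w. v \<bullet> (P *v w) = (P *v v) \<bullet> w) \<and> (\<forall>v. v \<noteq> 0 \<longrightarrow> 0 < v \<bullet> (P *v v)) \<and>
       0 \<le> 2 * trace A + \<gamma> * real CARD('n) \<and>
       (\<forall>a x. a \<le> 1 \<longrightarrow> 2 * ((P *v x) \<bullet> (closed_loop A b (P *v b) a *v x))
          \<le> (- \<gamma> + 2 * (1 - a) * (2 * trace A + \<gamma> * real CARD('n))) * (x \<bullet> (P *v x)))"
      unfolding bPb by blast
  qed
qed

section \<open>Growth of quadratic forms along Caratheodory solutions\<close>

text \<open>Bisecting the interval halves the constant \<open>C\<close>.\<close>

lemma nonincreasing_of_quadratic_bound:
  fixes g :: "real \<Rightarrow> real"
  assumes "a \<le> b" and g: "\<And>s t. a \<le> s \<Longrightarrow> s \<le> t \<Longrightarrow> t \<le> b \<Longrightarrow> g t - g s \<le> C * (t - s)\<^sup>2"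
  shows "g b \<le> g a"
proof -
  have step: "g t - g s \<le> C / 2 ^ k * (t - s)\<^sup>2" if "a \<le> s" "s \<le> t" "t \<le> b" for s t k
    using that
  proof (induction k arbitrary: s t)
    case 0 thus ?case using g by simp
  next
    case (Suc k)
    define m where "m = (s + t) / 2"
    have "a \<le> m" "s \<le> m" "m \<le> t" "m \<le> b" using Suc.prems by (auto simp: m_def)
    hence "g t - g m \<le> C / 2 ^ k * (t - m)\<^sup>2" "g m - g s \<le> C / 2 ^ k * (m - s)\<^sup>2"
      using Suc.prems Suc.IH by blast+
    moreover have "t - m = (t - s) / 2" "m - s = (t - s) / 2" by (auto simp: m_def field_simps)
    ultimately show ?case by (simp add: power_divide)
  qed
  have "(\<lambda>k. C * (b - a)\<^sup>2 * (1 / 2) ^ k) \<longlonglongrightarrow> C * (b - a)\<^sup>2 * 0"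
    by (intro tendsto_mult tendsto_const LIMSEQ_realpow_zero) auto
  moreover have "\<forall>k\<ge>0. g b - g a \<le> C * (b - a)\<^sup>2 * (1 / 2) ^ k"
    using step[of a b] assms(1) by (simp add: power_one_over field_simps)
  ultimately have "g b - g a \<le> C * (b - a)\<^sup>2 * 0" by (intro LIMSEQ_le_const) auto
  thus ?thesis by simp
qed

lemma caratheodory_increment:
  assumes x: "caratheodory_solution {0..} f x0 x" and st: "0 \<le> s" "s \<le> t"
  shows "((\<lambda>r. f r (x r)) has_integral (x t - x s)) {s..t}"
proof -
  have i: "(\<lambda>r. f r (x r)) integrable_on {0..t}"
    and e: "x t = x0 + integral {0..t} (\<lambda>r. f r (x r))" "x s = x0 + integral {0..s} (\<lambda>r. f r (x r))"
    using x st by (auto simp: caratheodory_solution_def intro!: set_lebesgue_integral_eq_integral(1))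
  have "x t - x s = integral {s..t} (\<lambda>r. f r (x r))"
    using Henstock_Kurzweil_Integration.integral_combine[OF st i] by (simp add: e algebra_simps)
  moreover have "(\<lambda>r. f r (x r)) integrable_on {s..t}"
    by (rule integrable_on_subinterval[OF i]) (use st in auto)
  ultimately show ?thesis by (simp add: has_integral_integral)
qed

text \<open>A substitute for differentiating the form along \<open>x\<close>, which solves its
  equation only in integral form. The state is frozen at one time \<open>c\<close> while
  \<open>M r\<close> keeps varying, so the hypothesis on the derivative is needed at the single
  state \<open>x c\<close>. Since \<open>x\<close> is Lipschitz on the interval, freezing costs only
  a term quadratic in its length. The free choice of \<open>c\<close> matters for the lower
  estimate.\<close>

lemma quadratic_form_increment:
  fixes M :: "real \<Rightarrow> real^'n^'n" and P :: "real^'n^'n"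
  assumes x: "caratheodory_solution {0..} (\<lambda>t y. M t *v y) x0 x"
    and L: "0 < L" "\<And>t v. 0 \<le> t \<Longrightarrow> norm (M t *v v) \<le> L * norm v"
    and P: "\<And>v w. v \<bullet> (P *v w) = (P *v v) \<bullet> w" and \<tau>: "0 \<le> \<tau>"
  obtains C where "0 \<le> C"
    "\<And>s t c \<psi>. \<lbrakk>0 \<le> s; s \<le> t; t \<le> \<tau>; c \<in> {s..t}; \<psi> integrable_on {s..t};
        \<And>r. r \<in> {s..t} \<Longrightarrow> 2 * ((P *v x c) \<bullet> (M r *v x c)) \<le> \<psi> r\<rbrakk>
      \<Longrightarrow> x t \<bullet> (P *v x t) - x s \<bullet> (P *v x s) \<le> integral {s..t} \<psi> + C * (t - s)\<^sup>2"
proof -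
  obtain p where p: "p > 0" "\<And>v. norm (P *v v) \<le> norm v * p"
    using bounded_linear.pos_bounded[OF matrix_vector_mul_bounded_linear[of P]] by auto
  have "continuous_on {0..\<tau>} x"
    using x unfolding caratheodory_solution_def by (auto elim: continuous_on_subset)
  then obtain B where B: "B > 0" "\<And>s. s \<in> {0..\<tau>} \<Longrightarrow> norm (x s) \<le> B"
    using compact_imp_bounded[OF compact_continuous_image[of "{0..\<tau>}" x]] unfolding bounded_pos
    by auto
  have MB: "norm (M r *v x c) \<le> L * B" if "r \<in> {0..\<tau>}" "c \<in> {0..\<tau>}" for r c
    using order_trans[OF L(2)[of r "x c"] mult_left_mono[OF B(2)[OF that(2)], of L]] L(1) that by simp
  have lip: "norm (x t - x s) \<le> L * B * (t - s)" if "0 \<le> s" "s \<le> t" "t \<le> \<tau>" for s t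
  proof -
    have I: "((\<lambda>r. M r *v x r) has_integral (x t - x s)) {s..t}"
      by (rule caratheodory_increment[OF x that(1,2)])
    have "norm (integral {s..t} (\<lambda>r. M r *v x r)) \<le> integral {s..t} (\<lambda>_. L * B)"
      by (rule integral_norm_bound_integral) (use I MB that in auto)
    thus ?thesis using that by (simp add: integral_unique[OF I] mult_ac)
  qed
  show thesis
  proof (rule that[of "4 * p * L\<^sup>2 * B\<^sup>2"])
    show "0 \<le> 4 * p * L\<^sup>2 * B\<^sup>2" using p by simp
    fix s t c :: real and \<psi> :: "real \<Rightarrow> real"
    assume st: "0 \<le> s" "s \<le> t" "t \<le> \<tau>" and c: "c \<in> {s..t}" and \<psi>: "\<psi> integrable_on {s..t}"
      and le: "\<And>r. r \<in> {s..t} \<Longrightarrow> 2 * ((P *v x c) \<bullet> (M r *v x c)) \<le> \<psi> r"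
    define h where "h = t - s"
    have h: "h \<ge> 0" using st by (simp add: h_def)
    have near: "norm (x r - x c) \<le> L * B * h" if "r \<in> {s..t}" for r
    proof -
      have "L * B * \<bar>r - c\<bar> \<le> L * B * h"
        using L B c that by (intro mult_left_mono) (auto simp: h_def)
      moreover have "norm (x r - x c) \<le> L * B * \<bar>r - c\<bar>"
        using lip[of c r] lip[of r c] c that st
        by (cases "c \<le> r") (auto simp: norm_minus_commute)
      ultimately show ?thesis by linarith
    qed
    \<comment> \<open>By symmetry of \<open>P\<close> the increment of the form equals
      \<open>w \<bullet> (x t - x s)\<close>, an integral in which \<open>w\<close> is constant.
      Replacing both end points by \<open>x c\<close> costs 2 units of
      \<open>p * L\<^sup>2 * B\<^sup>2 * h\<close>, and so does replacing \<open>x r\<close>; hence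
      the constant 4.\<close>
    define w where "w = P *v (x t + x s)"
    have I: "((\<lambda>r. w \<bullet> (M r *v x r)) has_integral (w \<bullet> (x t - x s))) {s..t}"
      using has_integral_linear[OF caratheodory_increment[OF x st(1,2)] bounded_linear_inner_right[of w]]
      by (simp add: o_def)
    have J: "((\<lambda>r. \<psi> r + 4 * p * L\<^sup>2 * B\<^sup>2 * h) has_integral
               (integral {s..t} \<psi> + 4 * p * L\<^sup>2 * B\<^sup>2 * h * (t - s))) {s..t}"
      using has_integral_add[OF integrable_integral[OF \<psi>]
          has_integral_const_real[of "4 * p * L\<^sup>2 * B\<^sup>2 * h" s t]] st
      by (simp add: mult_ac)
    have "w \<bullet> (x t - x s) \<le> integral {s..t} \<psi> + 4 * p * L\<^sup>2 * B\<^sup>2 * h * (t - s)"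
    proof (rule has_integral_le[OF I J])
      fix r assume r: "r \<in> {s..t}"
      have rc: "r \<in> {0..\<tau>}" "c \<in> {0..\<tau>}" using r c st by auto
      define d where "d = (x t - x c) + (x s - x c)"
      have "norm d \<le> 2 * (L * B * h)"
        using norm_triangle_ineq[of "x t - x c" "x s - x c"] near[of t] near[of s] st
        by (simp add: d_def)
      hence "norm (P *v d) \<le> 2 * (L * B * h) * p"
        using p(2)[of d] mult_right_mono[of "norm d" "2 * (L * B * h)" p] p(1) by linarith
      hence "norm (P *v d) * norm (M r *v x r) \<le> 2 * (L * B * h) * p * (L * B)"
        using MB[OF rc(1) rc(1)] by (intro mult_mono) (use p L B h in auto)
      hence 1: "(P *v d) \<bullet> (M r *v x r) \<le> 2 * p * L\<^sup>2 * B\<^sup>2 * h"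
        using norm_cauchy_schwarz[of "P *v d" "M r *v x r"] by (simp add: power2_eq_square mult_ac)
      have "norm (M r *v (x r - x c)) \<le> L * (L * B * h)"
        using order_trans[OF L(2)[of r "x r - x c"] mult_left_mono[OF near[OF r], of L]] L(1) rc by simp
      moreover have "norm (P *v x c) \<le> B * p"
        using p(2)[of "x c"] mult_right_mono[OF B(2)[OF rc(2)], of p] p(1) by linarith
      ultimately have "norm (P *v x c) * norm (M r *v (x r - x c)) \<le> B * p * (L * (L * B * h))"
        by (intro mult_mono) (use p L B h in auto)
      hence 2: "(P *v x c) \<bullet> (M r *v (x r - x c)) \<le> p * L\<^sup>2 * B\<^sup>2 * h"
        using norm_cauchy_schwarz[of "P *v x c" "M r *v (x r - x c)"]
        by (simp add: power2_eq_square mult_ac)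
      have "d = x t + x s - 2 *\<^sub>R x c" by (simp add: d_def scaleR_2)
      hence "w = P *v d + 2 *\<^sub>R (P *v x c)"
        by (simp add: w_def matrix_vector_mult_diff_distrib matrix_vector_mult_scaleR)
      hence "w \<bullet> (M r *v x r) = (P *v d) \<bullet> (M r *v x r) + 2 * ((P *v x c) \<bullet> (M r *v (x r - x c)))
          + 2 * ((P *v x c) \<bullet> (M r *v x c))"
        by (simp add: inner_add_left inner_diff_right matrix_vector_mult_diff_distrib)
      with 1 2 le[OF r] show "w \<bullet> (M r *v x r) \<le> \<psi> r + 4 * p * L\<^sup>2 * B\<^sup>2 * h" by simp
    qed
    moreover have "w \<bullet> (x t - x s) = x t \<bullet> (P *v x t) - x s \<bullet> (P *v x s)"
      using P[of "x s" "x t"]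
      by (simp add: w_def matrix_vector_right_distrib inner_add_left inner_diff_right
          inner_commute[of "P *v _"])
    ultimately show "x t \<bullet> (P *v x t) - x s \<bullet> (P *v x s)
        \<le> integral {s..t} \<psi> + 4 * p * L\<^sup>2 * B\<^sup>2 * (t - s)\<^sup>2"
      by (simp add: h_def power2_eq_square mult_ac)
  qed
qed

text \<open>A Gronwall argument with an integrable rate \<open>\<phi>\<close>: the form times
  \<open>exp (- \<Phi> t)\<close> is shown to be monotone, since on each subinterval it violates
  monotonicity by at most a quadratic error. The first order growth factor is absorbed by
  \<open>1 + y \<le> exp y\<close>.\<close>

lemma quadratic_form_growth:
  fixes M :: "real \<Rightarrow> real^'n^'n" and P :: "real^'n^'n"
  assumes x: "caratheodory_solution {0..} (\<lambda>t y. M t *v y) x0 x"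
    and L: "0 < L" "\<And>t v. 0 \<le> t \<Longrightarrow> norm (M t *v v) \<le> L * norm v"
    and P: "\<And>v w. v \<bullet> (P *v w) = (P *v v) \<bullet> w" "\<And>v. 0 \<le> v \<bullet> (P *v v)"
    and \<tau>: "0 \<le> \<tau>" and \<phi>: "\<phi> integrable_on {0..\<tau>}" "\<And>r. 0 \<le> r \<Longrightarrow> \<bar>\<phi> r\<bar> \<le> D"
  shows quadratic_form_upper:
      "(\<And>r v. 0 \<le> r \<Longrightarrow> 2 * ((P *v v) \<bullet> (M r *v v)) \<le> \<phi> r * (v \<bullet> (P *v v)))
        \<Longrightarrow> x \<tau> \<bullet> (P *v x \<tau>) \<le> x0 \<bullet> (P *v x0) * exp (integral {0..\<tau>} \<phi>)" (is "PROP ?U")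
    and quadratic_form_lower:
      "(\<And>r v. 0 \<le> r \<Longrightarrow> \<phi> r * (v \<bullet> (P *v v)) \<le> 2 * ((P *v v) \<bullet> (M r *v v)))
        \<Longrightarrow> x0 \<bullet> (P *v x0) * exp (integral {0..\<tau>} \<phi>) \<le> x \<tau> \<bullet> (P *v x \<tau>)" (is "PROP ?V")
proof -
  have x0: "x 0 = x0" using x by (auto simp: caratheodory_solution_def)
  define V where "V t = x t \<bullet> (P *v x t)" for t
  have V: "0 \<le> V t" for t using P(2) by (simp add: V_def)
  define \<Phi> where "\<Phi> t = integral {0..t} \<phi>" for t
  have sub: "\<phi> integrable_on {s..t}" if "0 \<le> s" "t \<le> \<tau>" for s t
    by (rule integrable_on_subinterval[OF \<phi>(1)]) (use that in auto)
  have diff: "integral {s..t} \<phi> = \<Phi> t - \<Phi> s" if "0 \<le> s" "s \<le> t" "t \<le> \<tau>" for s t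
    using Henstock_Kurzweil_Integration.integral_combine[OF that(1,2) sub[of 0 t]] that
    by (simp add: \<Phi>_def)
  have D: "0 \<le> D" using \<phi>(2)[of 0] by linarith
  \<comment> \<open>A bound on the weight over the whole interval keeps the constant of the
    quadratic error independent of \<open>s\<close> and \<open>t\<close>.\<close>
  have "- \<Phi> t \<le> D * \<tau>" if "t \<in> {0..\<tau>}" for t
  proof -
    have "norm (\<Phi> t) \<le> integral {0..t} (\<lambda>_. D)"
      unfolding \<Phi>_def using sub[of 0 t] that \<phi>(2)
      by (intro integral_norm_bound_integral) auto
    also have "\<dots> = D * t" using that by simp
    also have "\<dots> \<le> D * \<tau>" using that D by (simp add: mult_left_mono)
    finally show ?thesis by simp
  qed
  hence E: "exp (- \<Phi> t) \<le> exp (D * \<tau>)" if "t \<in> {0..\<tau>}" for t using that by simp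
  have \<Phi>0: "\<Phi> 0 = 0" by (simp add: \<Phi>_def)
  have weight: "v * exp (- \<Phi> t) \<le> w * exp (- \<Phi> s) + C * exp (D * \<tau>) * (t - s)\<^sup>2"
    if "v \<le> w * exp (\<Phi> t - \<Phi> s) + C * (t - s)\<^sup>2" "t \<in> {0..\<tau>}" "0 \<le> C" for v w C s t
  proof -
    have "v * exp (- \<Phi> t) \<le> (w * exp (\<Phi> t - \<Phi> s) + C * (t - s)\<^sup>2) * exp (- \<Phi> t)"
      using that(1) by (intro mult_right_mono) auto
    also have "\<dots> = w * exp (- \<Phi> s) + C * (t - s)\<^sup>2 * exp (- \<Phi> t)"
      by (simp add: algebra_simps flip: exp_add)
    also have "\<dots> \<le> w * exp (- \<Phi> s) + C * (t - s)\<^sup>2 * exp (D * \<tau>)"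
      using that E by (intro add_left_mono mult_left_mono) auto
    finally show ?thesis by (simp add: mult_ac)
  qed
  show "PROP ?U"
  proof -
    assume le: "\<And>r v. 0 \<le> r \<Longrightarrow> 2 * ((P *v v) \<bullet> (M r *v v)) \<le> \<phi> r * (v \<bullet> (P *v v))"
    obtain C where C: "0 \<le> C"
      and inc: "\<And>s t c \<psi>. \<lbrakk>0 \<le> s; s \<le> t; t \<le> \<tau>; c \<in> {s..t}; \<psi> integrable_on {s..t};
        \<And>r. r \<in> {s..t} \<Longrightarrow> 2 * ((P *v x c) \<bullet> (M r *v x c)) \<le> \<psi> r\<rbrakk>
      \<Longrightarrow> x t \<bullet> (P *v x t) - x s \<bullet> (P *v x s) \<le> integral {s..t} \<psi> + C * (t - s)\<^sup>2"
      using quadratic_form_increment[OF x L P(1) \<tau>] by blast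
    have "V \<tau> * exp (- \<Phi> \<tau>) \<le> V 0 * exp (- \<Phi> 0)"
    proof (rule nonincreasing_of_quadratic_bound[OF \<tau>])
      fix s t assume st: "0 \<le> s" "s \<le> t" "t \<le> \<tau>"
      \<comment> \<open>Freezing at the left end bounds \<open>V t\<close> by a multiple of
        \<open>V s\<close>.\<close>
      have "V t - V s \<le> integral {s..t} (\<lambda>r. \<phi> r * V s) + C * (t - s)\<^sup>2"
        unfolding V_def
        by (rule inc[where c=s]) (use st le sub in \<open>auto intro!: integrable_on_mult_left\<close>)
      also have "integral {s..t} (\<lambda>r. \<phi> r * V s) = (\<Phi> t - \<Phi> s) * V s" using diff[OF st] by simp
      finally have "V t \<le> V s * (1 + (\<Phi> t - \<Phi> s)) + C * (t - s)\<^sup>2" by (simp add: algebra_simps)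
      also have "V s * (1 + (\<Phi> t - \<Phi> s)) \<le> V s * exp (\<Phi> t - \<Phi> s)"
        by (intro mult_left_mono V exp_ge_add_one_self)
      finally show "V t * exp (- \<Phi> t) - V s * exp (- \<Phi> s) \<le> C * exp (D * \<tau>) * (t - s)\<^sup>2"
        using weight[of "V t" "V s" t s C] st C by simp
    qed
    thus "x \<tau> \<bullet> (P *v x \<tau>) \<le> x0 \<bullet> (P *v x0) * exp (integral {0..\<tau>} \<phi>)"
      by (simp add: \<Phi>0 V_def x0 exp_minus field_simps flip: \<Phi>_def)
  qed
  show "PROP ?V"
  proof -
    assume ge: "\<And>r v. 0 \<le> r \<Longrightarrow> \<phi> r * (v \<bullet> (P *v v)) \<le> 2 * ((P *v v) \<bullet> (M r *v v))"
    have "v \<bullet> (- P *v w) = (- P *v v) \<bullet> w" for v w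
      using P(1) by (simp add: uminus_matrix_vector_mult)
    from quadratic_form_increment[OF x L this \<tau>] obtain C where C: "0 \<le> C"
      and inc: "\<And>s t c \<psi>. \<lbrakk>0 \<le> s; s \<le> t; t \<le> \<tau>; c \<in> {s..t}; \<psi> integrable_on {s..t};
        \<And>r. r \<in> {s..t} \<Longrightarrow> 2 * ((- P *v x c) \<bullet> (M r *v x c)) \<le> \<psi> r\<rbrakk>
      \<Longrightarrow> x t \<bullet> (- P *v x t) - x s \<bullet> (- P *v x s) \<le> integral {s..t} \<psi> + C * (t - s)\<^sup>2"
      by blast
    have "- (V \<tau> * exp (- \<Phi> \<tau>)) \<le> - (V 0 * exp (- \<Phi> 0))"
    proof (rule nonincreasing_of_quadratic_bound[OF \<tau>])
      fix s t assume st: "0 \<le> s" "s \<le> t" "t \<le> \<tau>"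
      \<comment> \<open>With \<open>- P\<close> and freezing at the right end, \<open>V s\<close> is
        bounded by a multiple of \<open>V t\<close>, so that \<open>1 + y \<le> exp y\<close> again
        has the right direction.\<close>
      have "V s - V t \<le> integral {s..t} (\<lambda>r. \<phi> r * - V t) + C * (t - s)\<^sup>2"
        using inc[of s t t "\<lambda>r. \<phi> r * - V t"] st ge sub
          integrable_on_mult_left[OF sub[of s t], of "- V t"]
        by (simp add: V_def uminus_matrix_vector_mult)
      also have "integral {s..t} (\<lambda>r. \<phi> r * - V t) = (\<Phi> t - \<Phi> s) * - V t"
        using diff[OF st] by simp
      finally have "V s \<le> V t * (1 + (\<Phi> s - \<Phi> t)) + C * (t - s)\<^sup>2" by (simp add: algebra_simps)
      also have "V t * (1 + (\<Phi> s - \<Phi> t)) \<le> V t * exp (\<Phi> s - \<Phi> t)"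
        by (intro mult_left_mono V exp_ge_add_one_self)
      finally show "- (V t * exp (- \<Phi> t)) - - (V s * exp (- \<Phi> s)) \<le> C * exp (D * \<tau>) * (t - s)\<^sup>2"
        using weight[of "V s" "V t" s t C] st C by (simp add: power2_commute)
    qed
    thus "x0 \<bullet> (P *v x0) * exp (integral {0..\<tau>} \<phi>) \<le> x \<tau> \<bullet> (P *v x \<tau>)"
      by (simp add: \<Phi>0 V_def x0 exp_minus field_simps flip: \<Phi>_def)
  qed
qed

section \<open>Averaging over persistently exciting signals and choice of the gain\<close>

lemma PE_integrable:
  assumes "\<alpha> \<in> PE_signals T \<mu>" "0 \<le> s"
  shows "\<alpha> integrable_on {s..t}"
proof (rule measurable_bounded_by_integrable_imp_integrable)
  show "\<alpha> \<in> borel_measurable (lebesgue_on {s..t})"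
    by (rule measurable_restrict_mono[of \<alpha> lebesgue "{0..}"]) (use assms in \<open>auto simp: PE_signals_def\<close>)
  show "(\<lambda>_. 1::real) integrable_on {s..t}" by (rule integrable_const_ivl)
qed (use assms in \<open>auto simp: PE_signals_def\<close>)

text \<open>The interval is covered by consecutive windows of length \<open>T\<close>. Rounding up
  adds at most one window, a bounded excess that disappears after division by
  \<open>t\<close>.\<close>

lemma PE_deficit:
  assumes \<alpha>: "\<alpha> \<in> PE_signals T (\<rho> * T)" and T: "0 < T" and \<rho>: "\<rho> \<le> 1" and t: "0 \<le> t"
  shows "integral {0..t} (\<lambda>s. 1 - \<alpha> s) \<le> (1 - \<rho>) * (t + T)"
proof -
  have int: "(\<lambda>s. 1 - \<alpha> s) integrable_on {s..r}" if "0 \<le> s" for s r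
    by (intro Henstock_Kurzweil_Integration.integrable_diff integrable_const_ivl PE_integrable[OF \<alpha> that])
  have window: "integral {s..s+T} (\<lambda>s. 1 - \<alpha> s) \<le> (1 - \<rho>) * T" if "0 \<le> s" for s
    using \<alpha> T that PE_integrable[OF \<alpha> that]
    by (subst Henstock_Kurzweil_Integration.integral_diff)
       (auto simp: PE_signals_def algebra_simps)
  have N: "integral {0..real N * T} (\<lambda>s. 1 - \<alpha> s) \<le> real N * ((1 - \<rho>) * T)" for N
  proof (induction N)
    case (Suc N)
    have "integral {0..real (Suc N) * T} (\<lambda>s. 1 - \<alpha> s)
        = integral {0..real N * T} (\<lambda>s. 1 - \<alpha> s) + integral {real N * T..real N * T + T} (\<lambda>s. 1 - \<alpha> s)"
      using Henstock_Kurzweil_Integration.integral_combine[of 0 "real N * T" "real (Suc N) * T" "\<lambda>s. 1 - \<alpha> s"]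
        int T by (simp add: algebra_simps)
    also have "\<dots> \<le> real N * ((1 - \<rho>) * T) + (1 - \<rho>) * T"
      using T by (intro add_mono Suc.IH window) simp
    finally show ?case by (simp add: algebra_simps)
  qed simp
  define N where "N = nat \<lceil>t / T\<rceil>"
  have "real N \<ge> t / T" "real N \<le> t / T + 1"
    using t T by (auto simp: N_def of_nat_nat)
  hence tN: "t \<le> real N * T" "real N * T \<le> t + T"
    using T by (auto simp: field_simps)
  have "integral {0..t} (\<lambda>s. 1 - \<alpha> s) \<le> integral {0..real N * T} (\<lambda>s. 1 - \<alpha> s)"
    by (rule integral_subset_le) (use tN int \<alpha> in \<open>auto simp: PE_signals_def\<close>)
  also have "\<dots> \<le> (1 - \<rho>) * (real N * T)" using N[of N] by (simp add: mult_ac)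
  also have "\<dots> \<le> (1 - \<rho>) * (t + T)" using tN \<rho> by (intro mult_left_mono) auto
  finally show ?thesis .
qed

text \<open>\<open>P\<close>, \<open>K\<close> and \<open>E\<close> are fixed before the signal, as
  the supremum over signals requires; only \<open>\<phi>\<close> and its bound may depend on
  \<open>\<alpha>\<close>. The rate is \<open>2 * m\<close> because the form is quadratic in the
  state.\<close>

lemma fast_feedback:
  fixes A :: "real^'n^'n" and m :: real
  assumes ctrl: "\<forall>N. (\<forall>v\<in>N. b \<bullet> v = 0 \<and> transpose A *v v \<in> N) \<longrightarrow> N \<subseteq> {0}"
    and T: "0 < T" and \<rho>: "1 - 1 / (2 * real CARD('n)) < \<rho>" "\<rho> \<le> 1"
  obtains P K E where "\<And>v w. v \<bullet> (P *v w) = (P *v v) \<bullet> w" "\<And>v. v \<noteq> 0 \<Longrightarrow> 0 < v \<bullet> (P *v v)"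
    "\<And>\<alpha>. \<alpha> \<in> PE_signals T (\<rho> * T) \<Longrightarrow> \<exists>\<phi> D.
       (\<forall>t\<ge>0. \<phi> integrable_on {0..t} \<and> integral {0..t} \<phi> \<le> E - 2 * m * t \<and> \<bar>\<phi> t\<bar> \<le> D) \<and>
       (\<forall>t\<ge>0. \<forall>v. 2 * ((P *v v) \<bullet> (closed_loop A b K (\<alpha> t) *v v)) \<le> \<phi> t * (v \<bullet> (P *v v)))"
proof -
  define n where "n = real CARD('n)"
  have n: "n > 0" by (simp add: n_def)
  define \<delta> where "\<delta> = 1 - 2 * n * (1 - \<rho>)"
  have \<delta>: "\<delta> > 0" using \<rho>(1) n unfolding \<delta>_def n_def[symmetric] by (simp add: field_simps)
  obtain \<gamma>0 where fb: "\<And>\<gamma>. \<gamma>0 \<le> \<gamma> \<Longrightarrow> \<exists>P. (\<forall>v w. v \<bullet> (P *v w) = (P *v v) \<bullet> w) \<and> (\<forall>v. v \<noteq> 0 \<longrightarrow> 0 < v \<bullet> (P *v v)) \<and>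
       0 \<le> 2 * trace A + \<gamma> * real CARD('n) \<and>
       (\<forall>a x. a \<le> 1 \<longrightarrow> 2 * ((P *v x) \<bullet> (closed_loop A b (P *v b) a *v x))
          \<le> (- \<gamma> + 2 * (1 - a) * (2 * trace A + \<gamma> * real CARD('n))) * (x \<bullet> (P *v x)))"
    using lyapunov_feedback[OF ctrl] by blast
  \<comment> \<open>The mean rate is \<open>- \<gamma> + 2 * c * (1 - \<rho>) = - \<gamma> *
    \<delta> + 4 * (1 - \<rho>) * trace A\<close>. The second argument of the maximum brings it
    below \<open>- 2 * m\<close>; this is where the positivity of \<open>\<delta>\<close>, that is
    the threshold on \<open>\<rho>\<close>, enters.\<close>
  define \<gamma> where "\<gamma> = max \<gamma>0 ((2 * m + 4 * (1 - \<rho>) * trace A) / \<delta>)"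
  define c where "c = 2 * trace A + \<gamma> * n"
  have "\<gamma>0 \<le> \<gamma>" by (simp add: \<gamma>_def)
  from fb[OF this] obtain P where P: "\<And>v w. v \<bullet> (P *v w) = (P *v v) \<bullet> w" "\<And>v. v \<noteq> 0 \<Longrightarrow> 0 < v \<bullet> (P *v v)"
    and c: "0 \<le> c" and dec: "\<And>a x. a \<le> 1 \<Longrightarrow> 2 * ((P *v x) \<bullet> (closed_loop A b (P *v b) a *v x))
          \<le> (- \<gamma> + 2 * (1 - a) * c) * (x \<bullet> (P *v x))"
    unfolding c_def n_def by blast
  have "2 * m + 4 * (1 - \<rho>) * trace A \<le> \<gamma> * \<delta>"
    using \<delta> by (simp add: \<gamma>_def pos_divide_le_eq[symmetric])
  hence rate: "- \<gamma> + 2 * c * (1 - \<rho>) \<le> - 2 * m"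
    by (simp add: \<delta>_def c_def algebra_simps)
  show thesis
  proof (rule that[OF P, of "2 * c * (1 - \<rho>) * T" "P *v b"])
    fix \<alpha> assume \<alpha>: "\<alpha> \<in> PE_signals T (\<rho> * T)"
    have \<alpha>01: "0 \<le> \<alpha> t" "\<alpha> t \<le> 1" if "0 \<le> t" for t using \<alpha> that by (auto simp: PE_signals_def)
    define \<phi> where "\<phi> t = - \<gamma> + 2 * c * (1 - \<alpha> t)" for t
    have int: "(\<phi> has_integral (- \<gamma> * t + 2 * c * integral {0..t} (\<lambda>s. 1 - \<alpha> s))) {0..t}" if "0 \<le> t" for t
      unfolding \<phi>_def
      using has_integral_add[OF has_integral_const_real[of "- \<gamma>" 0 t]
          has_integral_mult_right[OF integrable_integral[OF Henstock_Kurzweil_Integration.integrable_diff[OF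
            integrable_const_ivl PE_integrable[OF \<alpha>, of 0]], of 1 t], of "2 * c"]] that
      by (simp add: mult_ac)
    have "integral {0..t} \<phi> \<le> 2 * c * (1 - \<rho>) * T - 2 * m * t" if "0 \<le> t" for t
    proof -
      have "integral {0..t} \<phi> \<le> - \<gamma> * t + 2 * c * ((1 - \<rho>) * (t + T))"
        unfolding integral_unique[OF int[OF that]]
        using PE_deficit[OF \<alpha> T \<rho>(2) that] c by (intro add_left_mono mult_left_mono) auto
      also have "\<dots> = (- \<gamma> + 2 * c * (1 - \<rho>)) * t + 2 * c * (1 - \<rho>) * T" by (simp add: algebra_simps)
      also have "\<dots> \<le> - 2 * m * t + 2 * c * (1 - \<rho>) * T"
        using rate that by (intro add_right_mono mult_right_mono) auto
      finally show ?thesis by simp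
    qed
    moreover have "\<bar>\<phi> t\<bar> \<le> \<bar>\<gamma>\<bar> + 2 * c" if "0 \<le> t" for t
    proof -
      have "0 \<le> c * (1 - \<alpha> t)" "c * (1 - \<alpha> t) \<le> c * 1"
        using \<alpha>01[OF that] c by (simp, intro mult_left_mono) auto
      thus ?thesis by (simp add: \<phi>_def)
    qed
    moreover have "2 * ((P *v v) \<bullet> (closed_loop A b (P *v b) (\<alpha> t) *v v)) \<le> \<phi> t * (v \<bullet> (P *v v))"
      if "0 \<le> t" for t v
      using dec[OF \<alpha>01(2)[OF that], of v] by (simp add: \<phi>_def mult_ac)
    ultimately show "\<exists>\<phi> D.
       (\<forall>t\<ge>0. \<phi> integrable_on {0..t} \<and> integral {0..t} \<phi> \<le> 2 * c * (1 - \<rho>) * T - 2 * m * t \<and> \<bar>\<phi> t\<bar> \<le> D) \<and>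
       (\<forall>t\<ge>0. \<forall>v. 2 * ((P *v v) \<bullet> (closed_loop A b (P *v b) (\<alpha> t) *v v)) \<le> \<phi> t * (v \<bullet> (P *v v)))"
      using int by (intro exI[of _ \<phi>] exI[of _ "\<bar>\<gamma>\<bar> + 2 * c"]) blast
  qed
qed

section \<open>From decay of the form to Lyapunov exponents\<close>

text \<open>The logarithm of the norm obeys the usual rules only while the state is nonzero. The
  lower growth estimate with the identity as \<open>P\<close> and the constant rate
  \<open>- (2 * L)\<close> guarantees this.\<close>

lemma trajectory_nonzero:
  fixes A :: "real^'n^'n"
  assumes \<alpha>: "\<alpha> \<in> PE_signals T \<mu>" and x0: "x0 \<noteq> 0" and t: "0 \<le> t"
  shows "trajectory A b K \<alpha> x0 t \<noteq> 0"
proof -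
  let ?x = "trajectory A b K \<alpha> x0"
  obtain L where L: "L > 0"
    "\<And>a v. 0 \<le> a \<Longrightarrow> a \<le> 1 \<Longrightarrow> norm (closed_loop A b K a *v v) \<le> L * norm v"
    using closed_loop_bound by blast
  have M: "norm (closed_loop A b K (\<alpha> t) *v v) \<le> L * norm v" if "0 \<le> t" for t v
    using L(2) \<alpha> that by (auto simp: PE_signals_def)
  have "- (2 * L) * (v \<bullet> v) \<le> 2 * (v \<bullet> (closed_loop A b K (\<alpha> r) *v v))" if "0 \<le> r" for r v
  proof -
    have "\<bar>v \<bullet> (closed_loop A b K (\<alpha> r) *v v)\<bar> \<le> norm v * (L * norm v)"
      using Cauchy_Schwarz_ineq2 mult_left_mono[OF M[OF that] norm_ge_zero] by (rule order_trans)
    thus ?thesis by (simp add: power2_norm_eq_inner[symmetric] power2_eq_square mult_ac)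
  qed
  hence "x0 \<bullet> (mat 1 *v x0) * exp (integral {0..t} (\<lambda>_. - (2 * L))) \<le> ?x t \<bullet> (mat 1 *v ?x t)"
    by (intro quadratic_form_lower[OF trajectory_solution[OF \<alpha>] L(1) M, where D = "2 * L"])
       (use t L(1) in auto)
  moreover have "0 < x0 \<bullet> x0 * exp (integral {0..t} (\<lambda>_. - (2 * L)))" using x0 by simp
  ultimately have "0 < ?x t \<bullet> ?x t" unfolding matrix_vector_mul_lid by linarith
  thus ?thesis by auto
qed

lemma exponent_limit: "((\<lambda>t::real. c / t + d) \<longlongrightarrow> d) at_top"
  using tendsto_add[OF tendsto_divide_0[OF tendsto_const[of c] filterlim_at_top_imp_at_infinity[OF filterlim_ident]]
      tendsto_const[of d]] by simp

lemma rc_ge: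
  fixes A :: "real^'n^'n"
  assumes ctrl: "\<forall>N. (\<forall>v\<in>N. b \<bullet> v = 0 \<and> transpose A *v v \<in> N) \<longrightarrow> N \<subseteq> {0}"
    and T: "0 < T" and \<rho>: "1 - 1 / (2 * real CARD('n)) < \<rho>" "\<rho> \<le> 1"
  shows "\<exists>K. ereal m \<le> rc A b T (\<rho> * T) K"
proof -
  \<comment> \<open>Asking for rate \<open>m + 1\<close> instead of \<open>m\<close> leaves room for
    the transient term \<open>c / t\<close>.\<close>
  obtain P K E where P: "\<And>v w. v \<bullet> (P *v w) = (P *v v) \<bullet> w" "\<And>v. v \<noteq> 0 \<Longrightarrow> 0 < v \<bullet> (P *v v)"
    and dec: "\<And>\<alpha>. \<alpha> \<in> PE_signals T (\<rho> * T) \<Longrightarrow> \<exists>\<phi> D.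
       (\<forall>t\<ge>0. \<phi> integrable_on {0..t} \<and> integral {0..t} \<phi> \<le> E - 2 * (m + 1) * t \<and> \<bar>\<phi> t\<bar> \<le> D) \<and>
       (\<forall>t\<ge>0. \<forall>v. 2 * ((P *v v) \<bullet> (closed_loop A b K (\<alpha> t) *v v)) \<le> \<phi> t * (v \<bullet> (P *v v)))"
    by (rule fast_feedback[OF ctrl T \<rho>, of "m + 1"]) (rule that)
  have P0: "0 \<le> v \<bullet> (P *v v)" for v using P(2)[of v] by (cases "v = 0") auto
  obtain L where L: "L > 0"
    "\<And>a v. 0 \<le> a \<Longrightarrow> a \<le> 1 \<Longrightarrow> norm (closed_loop A b K a *v v) \<le> L * norm v"
    using closed_loop_bound by blast
  obtain e where e: "norm e = 1" and min: "\<And>v. (e \<bullet> (P *v e)) * (v \<bullet> v) \<le> v \<bullet> (P *v v)"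
    using quadratic_form_minimizer by blast
  define q where "q = e \<bullet> (P *v e)"
  have q: "q > 0" unfolding q_def using e by (intro P(2)) auto
  have "Limsup at_top (\<lambda>t. ereal (ln (norm (trajectory A b K \<alpha> x0 t)) / t)) \<le> ereal (- m)"
    if \<alpha>: "\<alpha> \<in> PE_signals T (\<rho> * T)" and x0: "norm x0 = 1" for \<alpha> x0
  proof (rule Limsup_bounded)
    let ?x = "trajectory A b K \<alpha> x0"
    have x0': "x0 \<noteq> 0" using x0 by auto
    obtain \<phi> D where \<phi>: "\<And>t. 0 \<le> t \<Longrightarrow> \<phi> integrable_on {0..t}"
      "\<And>t. 0 \<le> t \<Longrightarrow> integral {0..t} \<phi> \<le> E - 2 * (m + 1) * t" "\<And>t. 0 \<le> t \<Longrightarrow> \<bar>\<phi> t\<bar> \<le> D"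
      "\<And>t v. 0 \<le> t \<Longrightarrow> 2 * ((P *v v) \<bullet> (closed_loop A b K (\<alpha> t) *v v)) \<le> \<phi> t * (v \<bullet> (P *v v))"
      using dec[OF \<alpha>] by blast
    \<comment> \<open>The halving comes from passing from the squared norm to the norm.\<close>
    define c where "c = (ln (x0 \<bullet> (P *v x0) / q) + E) / 2"
    have bound: "ln (norm (?x t)) / t \<le> c / t + (- (m + 1))" if t: "t > 0" for t
    proof -
      have x: "norm (?x t) > 0" using trajectory_nonzero[OF \<alpha> x0', of t A b K] t by simp
      have "norm (closed_loop A b K (\<alpha> t) *v v) \<le> L * norm v" if "0 \<le> t" for t v
        using L(2) \<alpha> that by (auto simp: PE_signals_def)
      hence "?x t \<bullet> (P *v ?x t) \<le> x0 \<bullet> (P *v x0) * exp (integral {0..t} \<phi>)"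
        using t by (intro quadratic_form_upper[OF trajectory_solution[OF \<alpha>] L(1) _ P(1) P0 _ \<phi>(1,3,4)]) auto
      also have "\<dots> \<le> x0 \<bullet> (P *v x0) * exp (E - 2 * (m + 1) * t)"
        using \<phi>(2)[of t] t P0 by (intro mult_left_mono) auto
      finally have "q * (norm (?x t))\<^sup>2 \<le> x0 \<bullet> (P *v x0) * exp (E - 2 * (m + 1) * t)"
        using min[of "?x t"] by (simp add: q_def power2_norm_eq_inner)
      hence "(norm (?x t))\<^sup>2 \<le> x0 \<bullet> (P *v x0) / q * exp (E - 2 * (m + 1) * t)"
        using q by (simp add: field_simps)
      hence "ln ((norm (?x t))\<^sup>2) \<le> ln (x0 \<bullet> (P *v x0) / q * exp (E - 2 * (m + 1) * t))"
        using x by (intro ln_mono) auto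
      also have "\<dots> = ln (x0 \<bullet> (P *v x0) / q) + (E - 2 * (m + 1) * t)"
        using P(2)[OF x0'] q by (subst ln_mult) auto
      finally have "ln (norm (?x t)) \<le> c - (m + 1) * t"
        using x by (simp add: c_def ln_realpow field_simps)
      from divide_right_mono[OF this, of t] show ?thesis using t by (simp add: diff_divide_distrib)
    qed
    have "\<forall>\<^sub>F t in at_top. c / t + (- (m + 1)) < - m"
      by (rule order_tendstoD(2)[OF exponent_limit]) simp
    with eventually_gt_at_top[of "0::real"]
    show "\<forall>\<^sub>F t in at_top. ereal (ln (norm (?x t)) / t) \<le> ereal (- m)"
    proof eventually_elim
      case (elim t)
      with bound[of t] show ?case unfolding ereal_less_eq by linarith
    qed
  qed
  hence "(SUP \<alpha>\<in>PE_signals T (\<rho> * T). lambda_plus A b K \<alpha>) \<le> ereal (- m)"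
    unfolding lambda_plus_def by (intro SUP_least) auto
  hence "- ereal (- m) \<le> rc A b T (\<rho> * T) K"
    unfolding rc_def ereal_minus_le_minus .
  hence "ereal m \<le> rc A b T (\<rho> * T) K" by simp
  thus ?thesis ..
qed

text \<open>The feedback built for \<open>- A\<close> is used with opposite sign for
  \<open>A\<close>. Time is not reversed: the same \<open>P\<close> now satisfies the reverse
  inequality with rate \<open>- \<phi> t\<close>, and the lower growth estimate applies.\<close>

lemma rd_ge:
  fixes A :: "real^'n^'n"
  assumes ctrl: "\<forall>N. (\<forall>v\<in>N. b \<bullet> v = 0 \<and> transpose (- A) *v v \<in> N) \<longrightarrow> N \<subseteq> {0}"
    and T: "0 < T" and \<rho>: "1 - 1 / (2 * real CARD('n)) < \<rho>" "\<rho> \<le> 1"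
  shows "\<exists>K. ereal m \<le> rd A b T (\<rho> * T) K"
proof -
  obtain P K' E where P: "\<And>v w. v \<bullet> (P *v w) = (P *v v) \<bullet> w" "\<And>v. v \<noteq> 0 \<Longrightarrow> 0 < v \<bullet> (P *v v)"
    and inc': "\<And>\<alpha>. \<alpha> \<in> PE_signals T (\<rho> * T) \<Longrightarrow> \<exists>\<phi> D.
       (\<forall>t\<ge>0. \<phi> integrable_on {0..t} \<and> integral {0..t} \<phi> \<le> E - 2 * (m + 1) * t \<and> \<bar>\<phi> t\<bar> \<le> D) \<and>
       (\<forall>t\<ge>0. \<forall>v. 2 * ((P *v v) \<bullet> (closed_loop (- A) b K' (\<alpha> t) *v v)) \<le> \<phi> t * (v \<bullet> (P *v v)))"
    by (rule fast_feedback[OF ctrl T \<rho>, of "m + 1"]) (rule that)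
  define K where "K = - K'"
  have flip: "closed_loop (- A) b K' a *v v = - (closed_loop A b K a *v v)" for a v
    using closed_loop_uminus[of A b K a v] by (simp add: K_def)
  have P0: "0 \<le> v \<bullet> (P *v v)" for v using P(2)[of v] by (cases "v = 0") auto
  obtain L where L: "L > 0"
    "\<And>a v. 0 \<le> a \<Longrightarrow> a \<le> 1 \<Longrightarrow> norm (closed_loop A b K a *v v) \<le> L * norm v"
    using closed_loop_bound by blast
  \<comment> \<open>Here the form must be bounded above by the squared norm, so an operator bound on
    \<open>P\<close> replaces the minimizer used in \<open>rc_ge\<close>.\<close>
  obtain q where q: "q > 0" "\<And>v. norm (P *v v) \<le> norm v * q"
    using bounded_linear.pos_bounded[OF matrix_vector_mul_bounded_linear[of P]] by auto
  have "ereal m \<le> Liminf at_top (\<lambda>t. ereal (ln (norm (trajectory A b K \<alpha> x0 t)) / t))"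
    if \<alpha>: "\<alpha> \<in> PE_signals T (\<rho> * T)" and x0: "norm x0 = 1" for \<alpha> x0
  proof (rule Liminf_bounded)
    let ?x = "trajectory A b K \<alpha> x0"
    have x0': "x0 \<noteq> 0" using x0 by auto
    obtain \<phi> D where \<phi>: "\<And>t. 0 \<le> t \<Longrightarrow> \<phi> integrable_on {0..t}"
      "\<And>t. 0 \<le> t \<Longrightarrow> integral {0..t} \<phi> \<le> E - 2 * (m + 1) * t" "\<And>t. 0 \<le> t \<Longrightarrow> \<bar>\<phi> t\<bar> \<le> D"
      "\<And>t v. 0 \<le> t \<Longrightarrow> - \<phi> t * (v \<bullet> (P *v v)) \<le> 2 * ((P *v v) \<bullet> (closed_loop A b K (\<alpha> t) *v v))"
    proof -
      obtain \<phi> D where \<phi>: "\<And>t. 0 \<le> t \<Longrightarrow> \<phi> integrable_on {0..t}"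
        "\<And>t. 0 \<le> t \<Longrightarrow> integral {0..t} \<phi> \<le> E - 2 * (m + 1) * t" "\<And>t. 0 \<le> t \<Longrightarrow> \<bar>\<phi> t\<bar> \<le> D"
        "\<And>t v. 0 \<le> t \<Longrightarrow> 2 * ((P *v v) \<bullet> (closed_loop (- A) b K' (\<alpha> t) *v v)) \<le> \<phi> t * (v \<bullet> (P *v v))"
        using inc'[OF \<alpha>] by blast
      have "- \<phi> t * (v \<bullet> (P *v v)) \<le> 2 * ((P *v v) \<bullet> (closed_loop A b K (\<alpha> t) *v v))"
        if "0 \<le> t" for t v
        using \<phi>(4)[OF that, of v] by (simp add: flip)
      with \<phi>(1-3) show thesis by (rule that)
    qed
    define c where "c = (ln (x0 \<bullet> (P *v x0) / q) - E) / 2"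
    have bound: "c / t + (m + 1) \<le> ln (norm (?x t)) / t" if t: "t > 0" for t
    proof -
      have x: "norm (?x t) > 0" using trajectory_nonzero[OF \<alpha> x0', of t A b K] t by simp
      have M: "norm (closed_loop A b K (\<alpha> t) *v v) \<le> L * norm v" if "0 \<le> t" for t v
        using L(2) \<alpha> that by (auto simp: PE_signals_def)
      have "x0 \<bullet> (P *v x0) * exp (2 * (m + 1) * t - E) \<le> x0 \<bullet> (P *v x0) * exp (integral {0..t} (\<lambda>r. - \<phi> r))"
        using \<phi>(2)[of t] t P0 by (intro mult_left_mono) auto
      also have "\<dots> \<le> ?x t \<bullet> (P *v ?x t)"
        using t \<phi>
        by (intro quadratic_form_lower[OF trajectory_solution[OF \<alpha>] L(1) M P(1) P0, where D = D]) (auto intro: integrable_neg)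
      also have "\<dots> \<le> norm (?x t) * (norm (?x t) * q)"
        using norm_cauchy_schwarz mult_left_mono[OF q(2) norm_ge_zero] by (rule order_trans)
      finally have "x0 \<bullet> (P *v x0) / q * exp (2 * (m + 1) * t - E) \<le> (norm (?x t))\<^sup>2"
        using q by (simp add: field_simps power2_eq_square)
      hence "ln (x0 \<bullet> (P *v x0) / q * exp (2 * (m + 1) * t - E)) \<le> ln ((norm (?x t))\<^sup>2)"
        using P(2)[OF x0'] q by (intro ln_mono) auto
      also have "ln (x0 \<bullet> (P *v x0) / q * exp (2 * (m + 1) * t - E))
          = ln (x0 \<bullet> (P *v x0) / q) + (2 * (m + 1) * t - E)"
        using P(2)[OF x0'] q by (subst ln_mult) auto
      finally have "c + (m + 1) * t \<le> ln (norm (?x t))"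
        using x by (simp add: c_def ln_realpow field_simps)
      from divide_right_mono[OF this, of t] show ?thesis using t by (simp add: add_divide_distrib)
    qed
    have "\<forall>\<^sub>F t in at_top. m < c / t + (m + 1)"
      by (rule order_tendstoD(1)[OF exponent_limit]) simp
    with eventually_gt_at_top[of "0::real"]
    show "\<forall>\<^sub>F t in at_top. ereal m \<le> ereal (ln (norm (?x t)) / t)"
    proof eventually_elim
      case (elim t)
      with bound[of t] show ?case unfolding ereal_less_eq by linarith
    qed
  qed
  hence "ereal m \<le> rd A b T (\<rho> * T) K"
    unfolding rd_def lambda_minus_def by (intro INF_greatest) auto
  thus ?thesis ..
qed

theorem proposition4p4:
  shows "\<exists>\<rho>s::real. 0 < \<rho>s \<and> \<rho>s < 1 \<and>
    (\<forall>(A :: real^'n^'n) (b :: real^'n) (T :: real) (\<rho> :: real).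
       controllable A b \<longrightarrow> T > 0 \<longrightarrow> \<rho>s < \<rho> \<longrightarrow> \<rho> \<le> 1 \<longrightarrow>
         RC A b T (\<rho> * T) = \<infinity> \<and> RD A b T (\<rho> * T) = \<infinity>)"
proof (intro exI[of _ "1 - 1 / (2 * real CARD('n))"] conjI allI impI)
  \<comment> \<open>The threshold is smallest in dimension one, where it equals one half.\<close>
  have "real CARD('n) \<ge> 1" by (simp add: Suc_leI)
  hence "1 < real CARD('n) * 2" by linarith
  thus "0 < 1 - 1 / (2 * real CARD('n))" "1 - 1 / (2 * real CARD('n)) < 1"
    by (simp_all add: field_simps)
  fix A :: "real^'n^'n" and b :: "real^'n" and T \<rho> :: real
  assume c: "controllable A b" and T: "T > 0" and \<rho>: "1 - 1 / (2 * real CARD('n)) < \<rho>" "\<rho> \<le> 1"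
  have ctrl: "\<forall>N. (\<forall>v\<in>N. b \<bullet> v = 0 \<and> transpose A *v v \<in> N) \<longrightarrow> N \<subseteq> {0}"
  proof (intro allI impI subsetI)
    fix N v assume "\<forall>v\<in>N. b \<bullet> v = 0 \<and> transpose A *v v \<in> N" and "v \<in> N"
    thus "v \<in> {0}" using controllable_invariant_trivial[OF c, of N v] by blast
  qed
  have uminus: "transpose (- A) *v w = - (transpose A *v w)" "transpose A *v (- w) = - (transpose A *v w)" for w
    using matrix_vector_mult_scaleR[of "transpose A" "- 1" w]
    by (simp_all add: transpose_def vec_eq_iff matrix_vector_mult_def sum_negf del: transpose_matrix_vector)
  have ctrl': "\<forall>N. (\<forall>v\<in>N. b \<bullet> v = 0 \<and> transpose (- A) *v v \<in> N) \<longrightarrow> N \<subseteq> {0}"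
  proof (intro allI impI)
    fix N assume "\<forall>v\<in>N. b \<bullet> v = 0 \<and> transpose (- A) *v v \<in> N"
    hence N: "b \<bullet> w = 0" "- (transpose A *v w) \<in> N" if "w \<in> N" for w
      using that unfolding uminus by blast+
    \<comment> \<open>A set stable under the negated transpose need not be stable under the
      transpose. Adding the negatives of its elements makes it so and keeps it orthogonal to
      \<open>b\<close>.\<close>
    have "\<forall>v\<in>N \<union> uminus ` N. b \<bullet> v = 0 \<and> transpose A *v v \<in> N \<union> uminus ` N"
    proof
      fix v assume "v \<in> N \<union> uminus ` N"
      then consider "v \<in> N" | w where "w \<in> N" "v = - w" by blast
      thus "b \<bullet> v = 0 \<and> transpose A *v v \<in> N \<union> uminus ` N"
      proof cases
        case 1
        have "transpose A *v v = - (- (transpose A *v v))" by simp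
        with N[OF 1] show ?thesis by blast
      next
        case 2
        with N[OF 2(1)] show ?thesis by (simp add: uminus(2) del: transpose_matrix_vector)
      qed
    qed
    with ctrl have "N \<union> uminus ` N \<subseteq> {0}" by blast
    thus "N \<subseteq> {0}" by blast
  qed
  have "ereal m \<le> RC A b T (\<rho> * T)" for m
    using rc_ge[OF ctrl T \<rho>, of m] unfolding RC_def by (auto intro: SUP_upper2)
  thus "RC A b T (\<rho> * T) = \<infinity>" by (rule ereal_top)
  have "ereal m \<le> RD A b T (\<rho> * T)" for m
    using rd_ge[OF ctrl' T \<rho>, of m] unfolding RD_def by (auto intro: SUP_upper2)
  thus "RD A b T (\<rho> * T) = \<infinity>" by (rule ereal_top)
qed

end
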